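(* For any sets of formulas $\Sigma,\Gamma\subseteq \mathit{Fm}_I$ and any formula $\varphi\in\mathit{Fm}_I$, the following three conditions are equivalent: $\Sigma;\Gamma\vdash\varphi$; $\Sigma;\Gamma\Vdash\varphi$; $\Sigma;\Gamma\models\varphi$. That is, $$\Sigma;\Gamma\vdash\varphi \iff \Sigma;\Gamma\Vdash\varphi \iff \Sigma;\Gamma\models\varphi .$$
   Context: Fix a finite non-empty set $I$. **Formulas.** $\mathit{Fm}_I$ is the set of formulas built from countably many propositional variables $p_0,p_1,\dots$ and the constant $\bot$ using $\to$, unary connectives $\Box_i$ ($i\in I$) and a unary connective $\mathsf{C}$. Abbreviations: $\neg\varphi:=\varphi\to\bot$, $\top:=\neg\bot$, $\varphi\wedge\psi:=\neg(\varphi\to\neg\psi)$, $\varphi\vee\psi:=\neg\varphi\to\psi$, $\mathsf{E}\varphi:=\bigwedge_{i\in I}\Box_i\varphi$. An empty conjunction is $\top$. **Axioms of $\mathsf{S4}^C_I$** (schemas): (i) classical propositional tautologies (in this language); (ii) $\Box_i(\varphi\to\psi)\to(\Box_i\varphi\to\Box_i\psi)$; (iii) $\Box_i\varphi\to\Box_i\Box_i\varphi$; (iv) $\Box_i\varphi\to\varphi$; (v) $\mathsf{C}(\varphi\to\psi)\to(\mathsf{C}\varphi\to\mathsf{C}\psi)$; (vi) $\mathsf{C}\varphi\to\mathsf{E}\varphi\wedge\mathsf{E}\mathsf{C}\varphi$; (vii) $\mathsf{E}\varphi\wedge\mathsf{C}(\varphi\to\mathsf{E}\varphi)\to\mathsf{C}\varphi$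 (for all $i\in I$). **Derivability.** An $\omega$-derivation is a well-founded tree whose nodes are marked by formulas and which is constructed according to the rules ($\mathsf{mp}$) from $\varphi$ and $\varphi\to\psi$ infer $\psi$; ($\mathsf{nec}$) from $\varphi$ infer $\mathsf{C}\varphi$; ($\omega$) from the infinitely many premises $\varphi_j\to\mathsf{E}\psi\wedge\mathsf{E}\varphi_{j+1}$ ($j\in\mathbb{N}$) infer $\varphi_0\to\mathsf{C}\psi$. An assumption leaf is a leaf not marked by an axiom. $\Sigma\vdash_g\varphi$ means there is an $\omega$-derivation with root marked by $\varphi$ in which all assumption leaves are marked by elements of $\Sigma$. $\Sigma;\Gamma\vdash\varphi$ means there is a finite $\Gamma_0\subseteq\Gamma$ with $\Sigma\vdash_g\bigwedge\Gamma_0\to\varphi$. **Algebras.** An interior algebra is a Boolean algebra with a unary operation $\Box$ such that $\Box1=1$, $\Box(x\wedge y)=\Box x\wedge\Box y$, $\Box x=\Box\Box x$, $\Box x\le x$. An $\mathsf{S4}^C_I$-algebra is a Boolean algebra $A$ with unary operations $\Box_i$ ($i\in I$) and $\mathsf{C}$ such that each $\Box_i$ and $\mathsf{C}$ make $A$ an interior algebra, and $\mathsf{C}a\le\mathsf{E}a\wedge\mathsf{E}\mathsf{C}a$ and $\mathsf{E}a\wedge\mathsf{C}(a\to\mathsf{E}a)\le\mathsf{C}a$ for all $a\in A$, where $\mathsf{E}a:=\bigwedge_{i\in I}\Box_i a$. It is standard if, for every element $d$ and every sequence $(a_j)_{j\in\mathbb{N}}$ with $a_j\le\mathsf{E}d\wedge\mathsf{E}a_{j+1}$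 for all $j$, we have $a_0\le\mathsf{C}d$. A valuation in an $\mathsf{S4}^C_I$-algebra with carrier $A$ is a map $v:\mathit{Fm}_I\to A$ with $v(\bot)=0$, $v(\varphi\to\psi)=v(\varphi)\to v(\psi)$, $v(\Box_i\varphi)=\Box_iv(\varphi)$, $v(\mathsf{C}\varphi)=\mathsf{C}v(\varphi)$. $\langle S\rangle$ denotes the filter generated by $S\subseteq A$. **Algebraic consequence.** $\Sigma;\Gamma\Vdash\varphi$ means: for every standard $\mathsf{S4}^C_I$-algebra and every valuation $v$ in it, if $v(\xi)=1$ for all $\xi\in\Sigma$, then $v(\varphi)\in\langle\{v(\psi)\mid\psi\in\Gamma\}\rangle$. **Topological consequence.** A topological $\mathsf{S4}^C_I$-model $\mathcal{M}$ consists of a set $X$, a family of topologies $(\tau_i)_{i\in I}$ on $X$, and a map $v:\mathit{Fm}_I\to\mathcal{P}(X)$ with $v(\bot)=\emptyset$, $v(\varphi\to\psi)=v(\psi)\cup(X\setminus v(\varphi))$, $v(\Box_i\varphi)=\mathrm{Int}_{\tau_i}(v(\varphi))$, $v(\mathsf{C}\varphi)=\mathrm{Int}_\tau(v(\varphi))$, where $\tau=\bigcap_{i\in I}\tau_i$ and $\mathrm{Int}$ denotes interior. $\mathcal{M},x\models\varphi$ means $x\in v(\varphi)$; $\mathcal{M}\models\varphi$ means $v(\varphi)=X$. $\Sigma;\Gamma\models\varphi$ means: for every topological $\mathsf{S4}^C_I$-model $\mathcal{M}$ and every point $x$ of it, if $\mathcal{M}\models\xi$ for all $\xi\in\Sigma$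 and $\mathcal{M},x\models\psi$ for all $\psi\in\Gamma$, then $\mathcal{M},x\models\varphi$. *)

theory Defs
  imports "HOL-Analysis.Abstract_Topology"
begin

text \<open>The index set \<open>I\<close> is the universe of a type \<open>'i\<close> of class \<open>finite\<close>
  (HOL types are non-empty).\<close>

datatype 'i fm =
    Var nat
  | Bot
  | Imp "'i fm" "'i fm"  (infixr \<open>\<^bold>\<rightarrow>\<close> 55)
  | Box 'i "'i fm"
  | Com "'i fm"

definition Neg :: "'i fm \<Rightarrow> 'i fm" where
  "Neg \<phi> = (\<phi> \<^bold>\<rightarrow> Bot)"

definition Top :: "'i fm" where
  "Top = Neg Bot"

definition Conj :: "'i fm \<Rightarrow> 'i fm \<Rightarrow> 'i fm"  (infixr \<open>\<^bold>\<and>\<close> 65) where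
  "(\<phi> \<^bold>\<and> \<psi>) = Neg (\<phi> \<^bold>\<rightarrow> Neg \<psi>)"

fun conj_list :: "'i fm list \<Rightarrow> 'i fm" where
  "conj_list [] = Top"
| "conj_list [\<phi>] = \<phi>"
| "conj_list (\<phi> # \<psi> # \<psi>s) = (\<phi> \<^bold>\<and> conj_list (\<psi> # \<psi>s))"

text \<open>A finite conjunction as a formula depends on an order of the conjuncts; one is
  fixed, once and for all, by choosing an enumeration of each finite set.\<close>

definition list_of :: "'a set \<Rightarrow> 'a list" where
  "list_of S = (SOME xs. set xs = S \<and> distinct xs)"

lemma list_of: "finite S \<Longrightarrow> set (list_of S) = S \<and> distinct (list_of S)"
  unfolding list_of_def by (rule someI_ex) (rule finite_distinct_list)

definition Conj_set :: "'i fm set \<Rightarrow> 'i fm" where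
  "Conj_set S = conj_list (list_of S)"

definition Ev :: "'i::finite fm \<Rightarrow> 'i fm" where
  "Ev \<phi> = conj_list (map (\<lambda>i. Box i \<phi>) (list_of UNIV))"

text \<open>Truth assignments treat variables and modalized formulas as atoms.\<close>

definition tautology :: "'i fm \<Rightarrow> bool" where
  "tautology \<phi> \<longleftrightarrow>
    (\<forall>w :: 'i fm \<Rightarrow> bool. \<not> w Bot \<and> (\<forall>\<psi> \<chi>. w (\<psi> \<^bold>\<rightarrow> \<chi>) \<longleftrightarrow> (w \<psi> \<longrightarrow> w \<chi>)) \<longrightarrow> w \<phi>)"

inductive S4C_axiom :: "'i::finite fm \<Rightarrow> bool" where
  taut: "tautology \<phi> \<Longrightarrow> S4C_axiom \<phi>"
| box_K: "S4C_axiom (Box i (\<phi> \<^bold>\<rightarrow> \<psi>) \<^bold>\<rightarrow> (Box i \<phi> \<^bold>\<rightarrow> Box i \<psi>))"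
| box_4: "S4C_axiom (Box i \<phi> \<^bold>\<rightarrow> Box i (Box i \<phi>))"
| box_T: "S4C_axiom (Box i \<phi> \<^bold>\<rightarrow> \<phi>)"
| com_K: "S4C_axiom (Com (\<phi> \<^bold>\<rightarrow> \<psi>) \<^bold>\<rightarrow> (Com \<phi> \<^bold>\<rightarrow> Com \<psi>))"
| com_mix: "S4C_axiom (Com \<phi> \<^bold>\<rightarrow> (Ev \<phi> \<^bold>\<and> Ev (Com \<phi>)))"
| com_ind: "S4C_axiom ((Ev \<phi> \<^bold>\<and> Com (\<phi> \<^bold>\<rightarrow> Ev \<phi>)) \<^bold>\<rightarrow> Com \<phi>)"

text \<open>Well-founded trees with nodes marked by formulas; values of the datatype are
  well-founded although \<open>Omega_node\<close> branches infinitely.\<close>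

datatype 'i tree =
    Leaf "'i fm"
  | Mp_node "'i fm" "'i tree" "'i tree"
  | Nec_node "'i fm" "'i tree"
  | Omega_node "'i fm" "nat \<Rightarrow> 'i tree"

primrec root_mark :: "'i tree \<Rightarrow> 'i fm" where
  "root_mark (Leaf \<chi>) = \<chi>"
| "root_mark (Mp_node \<chi> d e) = \<chi>"
| "root_mark (Nec_node \<chi> d) = \<chi>"
| "root_mark (Omega_node \<chi> f) = \<chi>"

primrec omega_derivation :: "'i::finite tree \<Rightarrow> bool" where
  "omega_derivation (Leaf \<chi>) \<longleftrightarrow> True"
| "omega_derivation (Mp_node \<chi> d e) \<longleftrightarrow>
    omega_derivation d \<and> omega_derivation e \<and> root_mark e = (root_mark d \<^bold>\<rightarrow> \<chi>)"
| "omega_derivation (Nec_node \<chi> d) \<longleftrightarrow>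
    omega_derivation d \<and> \<chi> = Com (root_mark d)"
| "omega_derivation (Omega_node \<chi> f) \<longleftrightarrow>
    (\<forall>j. omega_derivation (f j)) \<and>
    (\<exists>\<psi> \<phi>. (\<forall>j. root_mark (f j) = (\<phi> j \<^bold>\<rightarrow> (Ev \<psi> \<^bold>\<and> Ev (\<phi> (Suc j))))) \<and>
           \<chi> = (\<phi> 0 \<^bold>\<rightarrow> Com \<psi>))"

primrec assumptions :: "'i::finite tree \<Rightarrow> 'i fm set" where
  "assumptions (Leaf \<chi>) = (if S4C_axiom \<chi> then {} else {\<chi>})"
| "assumptions (Mp_node \<chi> d e) = assumptions d \<union> assumptions e"
| "assumptions (Nec_node \<chi> d) = assumptions d"
| "assumptions (Omega_node \<chi> f) = (\<Union>j. assumptions (f j))"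

definition derivable_g :: "'i::finite fm set \<Rightarrow> 'i fm \<Rightarrow> bool"  (infix \<open>\<turnstile>\<^sub>g\<close> 50) where
  "\<Sigma> \<turnstile>\<^sub>g \<phi> \<longleftrightarrow> (\<exists>d. omega_derivation d \<and> root_mark d = \<phi> \<and> assumptions d \<subseteq> \<Sigma>)"

definition derivable :: "'i::finite fm set \<Rightarrow> 'i fm set \<Rightarrow> 'i fm \<Rightarrow> bool" where
  "derivable \<Sigma> \<Gamma> \<phi> \<longleftrightarrow> (\<exists>\<Gamma>\<^sub>0. finite \<Gamma>\<^sub>0 \<and> \<Gamma>\<^sub>0 \<subseteq> \<Gamma> \<and> \<Sigma> \<turnstile>\<^sub>g (Conj_set \<Gamma>\<^sub>0 \<^bold>\<rightarrow> \<phi>))"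

text \<open>Boolean algebras with an explicit carrier; the axioms are those of the library
  locale \<open>abstract_boolean_algebra\<close>, relativized to the carrier.\<close>

record 'a bool_alg =
  carr :: "'a set"
  meet :: "'a \<Rightarrow> 'a \<Rightarrow> 'a"
  join :: "'a \<Rightarrow> 'a \<Rightarrow> 'a"
  compl :: "'a \<Rightarrow> 'a"
  zero :: 'a
  one :: 'a

definition boolean_alg :: "('a, 'm) bool_alg_scheme \<Rightarrow> bool" where
  "boolean_alg A \<longleftrightarrow>
    zero A \<in> carr A \<and> one A \<in> carr A \<and>
    (\<forall>x\<in>carr A. compl A x \<in> carr A \<and>
       meet A x (one A) = x \<and> join A x (zero A) = x \<and>
       meet A x (compl A x) = zero A \<and> join A x (compl A x) = one A) \<and>
    (\<forall>x\<in>carr A. \<forall>y\<in>carr A.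
       meet A x y \<in> carr A \<and> join A x y \<in> carr A \<and>
       meet A x y = meet A y x \<and> join A x y = join A y x) \<and>
    (\<forall>x\<in>carr A. \<forall>y\<in>carr A. \<forall>z\<in>carr A.
       meet A (meet A x y) z = meet A x (meet A y z) \<and>
       join A (join A x y) z = join A x (join A y z) \<and>
       meet A x (join A y z) = join A (meet A x y) (meet A x z) \<and>
       join A x (meet A y z) = meet A (join A x y) (join A x z))"

definition leq :: "('a, 'm) bool_alg_scheme \<Rightarrow> 'a \<Rightarrow> 'a \<Rightarrow> bool" where
  "leq A x y \<longleftrightarrow> meet A x y = x"

definition imp :: "('a, 'm) bool_alg_scheme \<Rightarrow> 'a \<Rightarrow> 'a \<Rightarrow> 'a" where
  "imp A x y = join A (compl A x) y"

definition interior_alg :: "('a, 'm) bool_alg_scheme \<Rightarrow> ('a \<Rightarrow> 'a) \<Rightarrow> bool" where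
  "interior_alg A f \<longleftrightarrow>
    boolean_alg A \<and>
    (\<forall>x\<in>carr A. f x \<in> carr A) \<and>
    f (one A) = one A \<and>
    (\<forall>x\<in>carr A. \<forall>y\<in>carr A. f (meet A x y) = meet A (f x) (f y)) \<and>
    (\<forall>x\<in>carr A. f x = f (f x)) \<and>
    (\<forall>x\<in>carr A. leq A (f x) x)"

record ('i, 'a) s4c_alg = "'a bool_alg" +
  box :: "'i \<Rightarrow> 'a \<Rightarrow> 'a"
  com :: "'a \<Rightarrow> 'a"

definition ev :: "('i::finite, 'a) s4c_alg \<Rightarrow> 'a \<Rightarrow> 'a" where
  "ev A a = foldr (meet A) (map (\<lambda>i. box A i a) (list_of UNIV)) (one A)"

definition S4C_algebra :: "('i::finite, 'a) s4c_alg \<Rightarrow> bool" where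
  "S4C_algebra A \<longleftrightarrow>
    boolean_alg A \<and>
    (\<forall>i. interior_alg A (box A i)) \<and>
    interior_alg A (com A) \<and>
    (\<forall>a\<in>carr A. leq A (com A a) (meet A (ev A a) (ev A (com A a)))) \<and>
    (\<forall>a\<in>carr A. leq A (meet A (ev A a) (com A (imp A a (ev A a)))) (com A a))"

definition standard :: "('i::finite, 'a) s4c_alg \<Rightarrow> bool" where
  "standard A \<longleftrightarrow>
    (\<forall>d\<in>carr A. \<forall>a :: nat \<Rightarrow> 'a. (\<forall>j. a j \<in> carr A) \<and>
       (\<forall>j. leq A (a j) (meet A (ev A d) (ev A (a (Suc j))))) \<longrightarrow>
       leq A (a 0) (com A d))"

definition alg_valuation :: "('i, 'a) s4c_alg \<Rightarrow> ('i fm \<Rightarrow> 'a) \<Rightarrow> bool" where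
  "alg_valuation A v \<longleftrightarrow>
    (\<forall>\<phi>. v \<phi> \<in> carr A) \<and>
    v Bot = zero A \<and>
    (\<forall>\<phi> \<psi>. v (\<phi> \<^bold>\<rightarrow> \<psi>) = imp A (v \<phi>) (v \<psi>)) \<and>
    (\<forall>i \<phi>. v (Box i \<phi>) = box A i (v \<phi>)) \<and>
    (\<forall>\<phi>. v (Com \<phi>) = com A (v \<phi>))"

definition alg_filter :: "('a, 'm) bool_alg_scheme \<Rightarrow> 'a set \<Rightarrow> bool" where
  "alg_filter A F \<longleftrightarrow>
    F \<subseteq> carr A \<and> one A \<in> F \<and>
    (\<forall>x\<in>F. \<forall>y\<in>F. meet A x y \<in> F) \<and>
    (\<forall>x\<in>F. \<forall>y\<in>carr A. leq A x y \<longrightarrow> y \<in> F)"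

definition filter_gen :: "('a, 'm) bool_alg_scheme \<Rightarrow> 'a set \<Rightarrow> 'a set" where
  "filter_gen A S = \<Inter> {F. alg_filter A F \<and> S \<subseteq> F}"

text \<open>HOL cannot quantify over types inside a proposition, so the two semantic consequence
  relations carry a type argument: carriers and point sets range over all subsets of that
  type. Consequence over the class of all structures is consequence at every type. The type
  \<open>'i fm set\<close> suffices for counterexamples: it holds the equivalence classes of formulas
  and the ultrafilters of the resulting quotient algebra (as sets of formulas).\<close>

definition alg_consequence ::
    "'a itself \<Rightarrow> 'i::finite fm set \<Rightarrow> 'i fm set \<Rightarrow> 'i fm \<Rightarrow> bool" where
  "alg_consequence (_ :: 'a itself) \<Sigma> \<Gamma> \<phi> \<longleftrightarrow>
    (\<forall>(A :: ('i, 'a) s4c_alg) v.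
       S4C_algebra A \<and> standard A \<and> alg_valuation A v \<and> (\<forall>\<xi>\<in>\<Sigma>. v \<xi> = one A) \<longrightarrow>
       v \<phi> \<in> filter_gen A (v ` \<Gamma>))"

definition inter_topology :: "('i \<Rightarrow> 'x topology) \<Rightarrow> 'x topology" where
  "inter_topology T = topology (\<lambda>U. \<forall>i. openin (T i) U)"

lemma openin_inter_topology: "openin (inter_topology T) U \<longleftrightarrow> (\<forall>i. openin (T i) U)"
proof -
  have "istopology (\<lambda>U. \<forall>i. openin (T i) U)"
    unfolding istopology_def by blast
  then show ?thesis
    by (simp add: inter_topology_def topology_inverse')
qed

definition top_model ::
    "'x set \<Rightarrow> ('i \<Rightarrow> 'x topology) \<Rightarrow> ('i fm \<Rightarrow> 'x set) \<Rightarrow> bool" where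
  "top_model X T v \<longleftrightarrow>
    (\<forall>i. topspace (T i) = X) \<and>
    (\<forall>\<phi>. v \<phi> \<subseteq> X) \<and>
    v Bot = {} \<and>
    (\<forall>\<phi> \<psi>. v (\<phi> \<^bold>\<rightarrow> \<psi>) = v \<psi> \<union> (X - v \<phi>)) \<and>
    (\<forall>i \<phi>. v (Box i \<phi>) = T i interior_of v \<phi>) \<and>
    (\<forall>\<phi>. v (Com \<phi>) = inter_topology T interior_of v \<phi>)"

definition top_consequence ::
    "'x itself \<Rightarrow> 'i::finite fm set \<Rightarrow> 'i fm set \<Rightarrow> 'i fm \<Rightarrow> bool" where
  "top_consequence (_ :: 'x itself) \<Sigma> \<Gamma> \<phi> \<longleftrightarrow>
    (\<forall>(X :: 'x set) (T :: 'i \<Rightarrow> 'x topology) v x.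
       top_model X T v \<and> x \<in> X \<and> (\<forall>\<xi>\<in>\<Sigma>. v \<xi> = X) \<and> (\<forall>\<psi>\<in>\<Gamma>. x \<in> v \<psi>) \<longrightarrow>
       x \<in> v \<phi>)"

end

theory Submission
  imports Defs
begin

text \<open>
  Soundness is an induction on derivation trees in a standard algebra: standardness is the
  semantic form of the \<open>\<omega>\<close>-rule. Tautologies have the value one because every element other
  than one is missed by some ultrafilter (\<open>ultrafilter_avoiding\<close>), and an ultrafilter turns a
  valuation into a truth assignment. A topological model is an algebra of subsets, and that
  algebra is standard: if \<open>a\<^sub>j\<close> is contained in every \<open>\<tau>\<^sub>i\<close>-interior of \<open>d\<close> and of \<open>a\<^sub>j\<^sub>+\<^sub>1\<close>, then the
  union of all \<open>a\<^sub>j\<close> is open in every \<open>\<tau>\<^sub>i\<close> and contained in \<open>d\<close>. So topological soundness is a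
  special case of algebraic soundness.

  For completeness, call a set of formulas a point if it is the set of truths of a truth
  assignment and contains everything globally derivable from \<open>\<Sigma>\<close>. Since local derivability uses
  only finitely many elements of \<open>\<Gamma>\<close>, Zorn's lemma shows that \<open>\<phi>\<close> is derivable from \<open>\<Sigma>;\<Gamma>\<close> iff
  every point that includes \<open>\<Gamma>\<close> contains \<open>\<phi>\<close> (\<open>derivable_iff_points\<close>). Hence Boolean reasoning
  about derivability becomes reasoning about the truth sets of formulas, the clopen sets of a
  Stone space.

  Algebraic completeness uses the Lindenbaum algebra; it is standard by the \<open>\<omega>\<close>-rule.
  Topological completeness takes the points as the space and lets the truth sets of formulas
  \<open>\<box>\<^sub>i\<psi>\<close> be a base of \<open>\<tau>\<^sub>i\<close>, as McKinsey and Tarski do for one modality. What has to be shown is that \<open>C\<close> is the interior of the intersection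
  topology (\<open>interior_of_truth_set_Com\<close>). Let \<open>U\<close> be open in every \<open>\<tau>\<^sub>i\<close>, contained in the truth set
  of \<open>\<phi>\<close>, and let \<open>a\<^sub>0\<close> be a formula whose truth set lies in \<open>U\<close>. This truth set is compact, so
  finitely many basic sets of each \<open>\<tau>\<^sub>i\<close> inside \<open>U\<close> cover it; the disjunction \<open>a\<^sub>1\<close> of the
  corresponding formulas again has its truth set in \<open>U\<close>, and \<open>a\<^sub>0\<close> implies \<open>Ea\<^sub>1\<close>
  (\<open>interpolating_Ev\<close>). Iterating gives a sequence to which the \<open>\<omega>\<close>-rule applies, so \<open>a\<^sub>0\<close> implies
  \<open>C\<phi>\<close>.
\<close>

section \<open>Truth assignments\<close>

definition truth_assignment :: "('i fm \<Rightarrow> bool) \<Rightarrow> bool" where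
  "truth_assignment w \<longleftrightarrow>
    \<not> w Bot \<and> (\<forall>\<psi> \<chi>. w (\<psi> \<^bold>\<rightarrow> \<chi>) \<longleftrightarrow> (w \<psi> \<longrightarrow> w \<chi>))"

lemma tautology_iff: "tautology \<phi> \<longleftrightarrow> (\<forall>w. truth_assignment w \<longrightarrow> w \<phi>)"
  by (simp add: tautology_def truth_assignment_def)

lemma truth_assignment_connectives:
  assumes "truth_assignment w"
  shows "\<not> w Bot" and "w (\<phi> \<^bold>\<rightarrow> \<psi>) \<longleftrightarrow> (w \<phi> \<longrightarrow> w \<psi>)" and "w (Neg \<phi>) \<longleftrightarrow> \<not> w \<phi>"
    and "w Top" and "w (\<phi> \<^bold>\<and> \<psi>) \<longleftrightarrow> w \<phi> \<and> w \<psi>"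
  using assms by (auto simp: truth_assignment_def Neg_def Top_def Conj_def)

lemma truth_assignment_conj_list:
  assumes "truth_assignment w"
  shows "w (conj_list \<phi>s) \<longleftrightarrow> (\<forall>\<phi>\<in>set \<phi>s. w \<phi>)"
  by (induction \<phi>s rule: conj_list.induct) (auto simp: truth_assignment_connectives[OF assms])

lemma truth_assignment_Conj_set:
  assumes "truth_assignment w" "finite S"
  shows "w (Conj_set S) \<longleftrightarrow> (\<forall>\<phi>\<in>S. w \<phi>)"
  using assms list_of[of S] by (simp add: Conj_set_def truth_assignment_conj_list)

lemma truth_assignment_Ev:
  fixes w :: "'i::finite fm \<Rightarrow> bool"
  assumes "truth_assignment w"
  shows "w (Ev \<phi>) \<longleftrightarrow> (\<forall>i. w (Box i \<phi>))"
  using assms list_of[of "UNIV :: 'i set"] by (simp add: Ev_def truth_assignment_conj_list)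

lemmas truth_assignment_simps = truth_assignment_connectives truth_assignment_conj_list
  truth_assignment_Conj_set truth_assignment_Ev

section \<open>Global derivability\<close>

lemma derivable_g_assumption: "\<phi> \<in> \<Sigma> \<Longrightarrow> \<Sigma> \<turnstile>\<^sub>g \<phi>"
  unfolding derivable_g_def by (rule exI[of _ "Leaf \<phi>"]) simp

lemma derivable_g_axiom: "S4C_axiom \<phi> \<Longrightarrow> \<Sigma> \<turnstile>\<^sub>g \<phi>"
  unfolding derivable_g_def by (rule exI[of _ "Leaf \<phi>"]) simp

lemma derivable_g_mp:
  assumes "\<Sigma> \<turnstile>\<^sub>g (\<phi> \<^bold>\<rightarrow> \<psi>)" "\<Sigma> \<turnstile>\<^sub>g \<phi>"
  shows "\<Sigma> \<turnstile>\<^sub>g \<psi>"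
proof -
  obtain d e where "omega_derivation d" "root_mark d = \<phi>" "assumptions d \<subseteq> \<Sigma>"
    "omega_derivation e" "root_mark e = (\<phi> \<^bold>\<rightarrow> \<psi>)" "assumptions e \<subseteq> \<Sigma>"
    using assms unfolding derivable_g_def by blast
  then show ?thesis
    unfolding derivable_g_def by (intro exI[of _ "Mp_node \<psi> d e"]) simp
qed

lemma derivable_g_nec: "\<Sigma> \<turnstile>\<^sub>g \<phi> \<Longrightarrow> \<Sigma> \<turnstile>\<^sub>g Com \<phi>"
  unfolding derivable_g_def by (metis assumptions.simps(3) omega_derivation.simps(3) root_mark.simps(3))

lemma derivable_g_omega:
  assumes "\<And>j. \<Sigma> \<turnstile>\<^sub>g (\<phi> j \<^bold>\<rightarrow> (Ev \<psi> \<^bold>\<and> Ev (\<phi> (Suc j))))"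
  shows "\<Sigma> \<turnstile>\<^sub>g (\<phi> 0 \<^bold>\<rightarrow> Com \<psi>)"
proof -
  obtain f where "\<And>j. omega_derivation (f j) \<and> assumptions (f j) \<subseteq> \<Sigma> \<and>
      root_mark (f j) = (\<phi> j \<^bold>\<rightarrow> (Ev \<psi> \<^bold>\<and> Ev (\<phi> (Suc j))))"
    using assms unfolding derivable_g_def by metis
  then show ?thesis
    unfolding derivable_g_def by (intro exI[of _ "Omega_node (\<phi> 0 \<^bold>\<rightarrow> Com \<psi>) f"]) auto
qed

lemma derivable_g_tautological_consequence:
  assumes "\<Sigma> \<turnstile>\<^sub>g \<phi>" "tautology (\<phi> \<^bold>\<rightarrow> \<psi>)"
  shows "\<Sigma> \<turnstile>\<^sub>g \<psi>"
  using assms derivable_g_mp derivable_g_axiom taut by blast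

text \<open>Every \<open>Box i\<close> and \<open>Com\<close> satisfy this, so the facts about truth sets that say "\<open>M\<close> acts as an
  interior operator" are proved once for all of them.\<close>

definition S4_modality :: "'i::finite fm set \<Rightarrow> ('i fm \<Rightarrow> 'i fm) \<Rightarrow> bool" where
  "S4_modality \<Sigma> M \<longleftrightarrow>
    (\<forall>\<phi>. \<Sigma> \<turnstile>\<^sub>g \<phi> \<longrightarrow> \<Sigma> \<turnstile>\<^sub>g M \<phi>) \<and>
    (\<forall>\<phi> \<psi>. \<Sigma> \<turnstile>\<^sub>g (M (\<phi> \<^bold>\<rightarrow> \<psi>) \<^bold>\<rightarrow> (M \<phi> \<^bold>\<rightarrow> M \<psi>))) \<and>
    (\<forall>\<phi>. \<Sigma> \<turnstile>\<^sub>g (M \<phi> \<^bold>\<rightarrow> M (M \<phi>))) \<and>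
    (\<forall>\<phi>. \<Sigma> \<turnstile>\<^sub>g (M \<phi> \<^bold>\<rightarrow> \<phi>))"

lemma derivable_g_Com_imp_Box: "\<Sigma> \<turnstile>\<^sub>g (Com \<phi> \<^bold>\<rightarrow> Box i \<phi>)"
  by (rule derivable_g_tautological_consequence[OF derivable_g_axiom[OF com_mix[of \<phi>]]])
    (simp add: tautology_iff truth_assignment_simps)

lemma S4_modality_Box: "S4_modality \<Sigma> (Box i)"
  unfolding S4_modality_def
  by (auto intro: derivable_g_axiom box_K box_4 box_T derivable_g_nec
      derivable_g_mp[OF derivable_g_Com_imp_Box])

text \<open>Reflexivity goes through \<open>Box i\<close> for an arbitrary index, which exists because the index type is
  inhabited. Transitivity is the induction axiom for \<open>Com \<phi>\<close>: the formula \<open>Com \<phi> \<^bold>\<rightarrow> Ev (Com \<phi>)\<close> is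
  derivable, and so is its necessitation.\<close>

lemma S4_modality_Com: "S4_modality \<Sigma> (Com :: 'i::finite fm \<Rightarrow> 'i fm)"
proof -
  have T: "\<Sigma> \<turnstile>\<^sub>g (Com \<phi> \<^bold>\<rightarrow> \<phi>)" for \<phi> :: "'i fm"
  proof -
    let ?B = "Box (undefined :: 'i) \<phi>"
    have "\<Sigma> \<turnstile>\<^sub>g ((?B \<^bold>\<rightarrow> \<phi>) \<^bold>\<rightarrow> (Com \<phi> \<^bold>\<rightarrow> \<phi>))"
      by (rule derivable_g_tautological_consequence[OF
          derivable_g_Com_imp_Box[of \<Sigma> \<phi> undefined]])
        (simp add: tautology_iff truth_assignment_simps)
    then show ?thesis
      using derivable_g_axiom[OF box_T] derivable_g_mp by blast
  qed
  have "\<Sigma> \<turnstile>\<^sub>g (Com \<phi> \<^bold>\<rightarrow> Com (Com \<phi>))" for \<phi> :: "'i fm"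
  proof -
    have "\<Sigma> \<turnstile>\<^sub>g (Com \<phi> \<^bold>\<rightarrow> Ev (Com \<phi>))"
      by (rule derivable_g_tautological_consequence[OF derivable_g_axiom[OF com_mix[of \<phi>]]])
        (simp add: tautology_iff truth_assignment_simps)
    moreover from this have "\<Sigma> \<turnstile>\<^sub>g Com (Com \<phi> \<^bold>\<rightarrow> Ev (Com \<phi>))"
      by (rule derivable_g_nec)
    moreover have "\<Sigma> \<turnstile>\<^sub>g ((Com \<phi> \<^bold>\<rightarrow> Ev (Com \<phi>)) \<^bold>\<rightarrow>
        (Com (Com \<phi> \<^bold>\<rightarrow> Ev (Com \<phi>)) \<^bold>\<rightarrow> (Com \<phi> \<^bold>\<rightarrow> Com (Com \<phi>))))"
      by (rule derivable_g_tautological_consequence[OF derivable_g_axiom[OF com_ind[of "Com \<phi>"]]])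
        (simp add: tautology_iff truth_assignment_simps)
    ultimately show ?thesis
      using derivable_g_mp by blast
  qed
  then show ?thesis
    unfolding S4_modality_def using T derivable_g_axiom com_K derivable_g_nec by blast
qed

section \<open>Points of the canonical model\<close>

lemma derivable_theorem:
  assumes "\<Sigma> \<turnstile>\<^sub>g \<phi>"
  shows "derivable \<Sigma> \<Gamma> \<phi>"
proof -
  have "\<Sigma> \<turnstile>\<^sub>g (Conj_set {} \<^bold>\<rightarrow> \<phi>)"
    by (rule derivable_g_tautological_consequence[OF assms])
      (simp add: tautology_iff truth_assignment_simps)
  then show ?thesis
    unfolding derivable_def by blast
qed

lemma derivable_hypothesis:
  assumes "\<phi> \<in> \<Gamma>"
  shows "derivable \<Sigma> \<Gamma> \<phi>"
proof -
  have "\<Sigma> \<turnstile>\<^sub>g (Conj_set {\<phi>} \<^bold>\<rightarrow> \<phi>)"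
    by (rule derivable_g_axiom, rule taut) (simp add: tautology_iff truth_assignment_simps)
  then show ?thesis
    using assms unfolding derivable_def by (intro exI[of _ "{\<phi>}"]) simp
qed

lemma derivable_mp:
  assumes "derivable \<Sigma> \<Gamma> (\<phi> \<^bold>\<rightarrow> \<psi>)" "derivable \<Sigma> \<Gamma> \<phi>"
  shows "derivable \<Sigma> \<Gamma> \<psi>"
proof -
  obtain A B where A: "finite A" "A \<subseteq> \<Gamma>" "\<Sigma> \<turnstile>\<^sub>g (Conj_set A \<^bold>\<rightarrow> (\<phi> \<^bold>\<rightarrow> \<psi>))"
    and B: "finite B" "B \<subseteq> \<Gamma>" "\<Sigma> \<turnstile>\<^sub>g (Conj_set B \<^bold>\<rightarrow> \<phi>)"
    using assms unfolding derivable_def by blast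
  have "\<Sigma> \<turnstile>\<^sub>g ((Conj_set B \<^bold>\<rightarrow> \<phi>) \<^bold>\<rightarrow> (Conj_set (A \<union> B) \<^bold>\<rightarrow> \<psi>))"
    using A B by (intro derivable_g_tautological_consequence[OF A(3)])
      (auto simp: tautology_iff truth_assignment_simps)
  then have "\<Sigma> \<turnstile>\<^sub>g (Conj_set (A \<union> B) \<^bold>\<rightarrow> \<psi>)"
    using B(3) by (rule derivable_g_mp)
  then show ?thesis
    using A B unfolding derivable_def by (intro exI[of _ "A \<union> B"]) simp
qed

lemma deduction_theorem:
  assumes "derivable \<Sigma> (insert \<phi> \<Gamma>) \<psi>"
  shows "derivable \<Sigma> \<Gamma> (\<phi> \<^bold>\<rightarrow> \<psi>)"
proof -
  obtain A where A: "finite A" "A \<subseteq> insert \<phi> \<Gamma>" "\<Sigma> \<turnstile>\<^sub>g (Conj_set A \<^bold>\<rightarrow> \<psi>)"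
    using assms unfolding derivable_def by blast
  have "\<Sigma> \<turnstile>\<^sub>g (Conj_set (A - {\<phi>}) \<^bold>\<rightarrow> (\<phi> \<^bold>\<rightarrow> \<psi>))"
    using A by (intro derivable_g_tautological_consequence[OF A(3)])
      (auto simp: tautology_iff truth_assignment_simps)
  then show ?thesis
    using A unfolding derivable_def by (intro exI[of _ "A - {\<phi>}"]) auto
qed

text \<open>These are the ultrafilters of the Lindenbaum algebra, each represented by the set of formulas
  whose classes belong to it.\<close>

definition points :: "'i::finite fm set \<Rightarrow> 'i fm set set" where
  "points \<Sigma> = {x. truth_assignment (\<lambda>\<phi>. \<phi> \<in> x) \<and> (\<forall>\<phi>. \<Sigma> \<turnstile>\<^sub>g \<phi> \<longrightarrow> \<phi> \<in> x)}"

lemma points_mem: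
  assumes "x \<in> points \<Sigma>"
  shows "Bot \<notin> x" and "(\<phi> \<^bold>\<rightarrow> \<psi>) \<in> x \<longleftrightarrow> (\<phi> \<in> x \<longrightarrow> \<psi> \<in> x)" and "Neg \<phi> \<in> x \<longleftrightarrow> \<phi> \<notin> x"
    and "Top \<in> x" and "(\<phi> \<^bold>\<and> \<psi>) \<in> x \<longleftrightarrow> \<phi> \<in> x \<and> \<psi> \<in> x"
    and "finite S \<Longrightarrow> Conj_set S \<in> x \<longleftrightarrow> S \<subseteq> x"
    and "Ev \<phi> \<in> x \<longleftrightarrow> (\<forall>i. Box i \<phi> \<in> x)"
proof -
  have "truth_assignment (\<lambda>\<phi>. \<phi> \<in> x)"
    using assms by (simp add: points_def)
  note * = truth_assignment_simps[OF this]
  show "Bot \<notin> x" and "(\<phi> \<^bold>\<rightarrow> \<psi>) \<in> x \<longleftrightarrow> (\<phi> \<in> x \<longrightarrow> \<psi> \<in> x)" and "Neg \<phi> \<in> x \<longleftrightarrow> \<phi> \<notin> x"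
    and "Top \<in> x" and "(\<phi> \<^bold>\<and> \<psi>) \<in> x \<longleftrightarrow> \<phi> \<in> x \<and> \<psi> \<in> x"
    and "finite S \<Longrightarrow> Conj_set S \<in> x \<longleftrightarrow> S \<subseteq> x"
    and "Ev \<phi> \<in> x \<longleftrightarrow> (\<forall>i. Box i \<phi> \<in> x)"
    using * by auto
qed

lemma points_theorem: "x \<in> points \<Sigma> \<Longrightarrow> \<Sigma> \<turnstile>\<^sub>g \<phi> \<Longrightarrow> \<phi> \<in> x"
  by (simp add: points_def)

text \<open>By the deduction theorem, everything outside \<open>x\<close> implies \<open>\<phi>\<close> there; this replaces the usual
  appeal to negation. The one case that needs an idea is that \<open>\<psi> \<^bold>\<rightarrow> \<chi>\<close> belongs to \<open>x\<close> when \<open>\<psi>\<close>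
  does not: otherwise both \<open>\<psi>\<close> and \<open>\<psi> \<^bold>\<rightarrow> \<chi>\<close> imply \<open>\<phi>\<close>, and one of them is always true.\<close>

lemma maximal_underivable_is_point:
  assumes "\<not> derivable \<Sigma> x \<phi>" and max: "\<And>\<psi>. \<psi> \<notin> x \<Longrightarrow> derivable \<Sigma> (insert \<psi> x) \<phi>"
  shows "x \<in> points \<Sigma>"
proof -
  have imp: "derivable \<Sigma> x (\<psi> \<^bold>\<rightarrow> \<phi>)" if "\<psi> \<notin> x" for \<psi>
    using max[OF that] by (rule deduction_theorem)
  have closed: "\<psi> \<in> x" if "derivable \<Sigma> x \<psi>" for \<psi>
    using that imp derivable_mp assms(1) by blast
  have taut: "\<psi> \<in> x" if "tautology \<psi>" for \<psi>
    using that by (intro closed derivable_theorem derivable_g_axiom S4C_axiom.taut)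
  have mp: "\<chi> \<in> x" if "(\<psi> \<^bold>\<rightarrow> \<chi>) \<in> x" "\<psi> \<in> x" for \<psi> \<chi>
    using that by (intro closed) (meson derivable_hypothesis derivable_mp)
  have "\<phi> \<notin> x"
    using assms(1) derivable_hypothesis by blast
  have imp_mem: "(\<psi> \<^bold>\<rightarrow> \<phi>) \<in> x" if "\<psi> \<notin> x" for \<psi>
    using closed imp that by blast
  have "Bot \<notin> x"
    using \<open>\<phi> \<notin> x\<close> mp[of Bot \<phi>] taut[of "Bot \<^bold>\<rightarrow> \<phi>"]
    by (auto simp: tautology_iff truth_assignment_simps)
  moreover have "(\<psi> \<^bold>\<rightarrow> \<chi>) \<in> x" if "\<chi> \<in> x" for \<psi> \<chi>
    using mp[OF taut that, of "\<psi> \<^bold>\<rightarrow> \<chi>"] by (simp add: tautology_iff truth_assignment_simps)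
  moreover have "(\<psi> \<^bold>\<rightarrow> \<chi>) \<in> x" if "\<psi> \<notin> x" for \<psi> \<chi>
  proof (rule ccontr)
    assume "(\<psi> \<^bold>\<rightarrow> \<chi>) \<notin> x"
    have "((\<psi> \<^bold>\<rightarrow> \<phi>) \<^bold>\<rightarrow> (((\<psi> \<^bold>\<rightarrow> \<chi>) \<^bold>\<rightarrow> \<phi>) \<^bold>\<rightarrow> \<phi>)) \<in> x"
      by (rule taut) (auto simp: tautology_iff truth_assignment_simps)
    then have "\<phi> \<in> x"
      using imp_mem[OF that] imp_mem[OF \<open>(\<psi> \<^bold>\<rightarrow> \<chi>) \<notin> x\<close>] mp by blast
    with \<open>\<phi> \<notin> x\<close> show False ..
  qed
  ultimately have "truth_assignment (\<lambda>\<phi>. \<phi> \<in> x)"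
    unfolding truth_assignment_def using mp by blast
  then show ?thesis
    using closed derivable_theorem by (auto simp: points_def)
qed

lemma point_extending_exists:
  assumes "\<not> derivable \<Sigma> \<Gamma> \<phi>"
  obtains x where "x \<in> points \<Sigma>" "\<Gamma> \<subseteq> x" "\<phi> \<notin> x"
proof -
  define S where "S = {x. \<Gamma> \<subseteq> x \<and> \<not> derivable \<Sigma> x \<phi>}"
  have "\<exists>x\<in>S. \<forall>y\<in>S. x \<subseteq> y \<longrightarrow> y = x"
  proof (rule subset_Zorn_nonempty)
    show "S \<noteq> {}"
      using assms by (auto simp: S_def)
    fix \<C> assume C: "\<C> \<noteq> {}" "subset.chain S \<C>"
    have "\<not> derivable \<Sigma> (\<Union>\<C>) \<phi>"
    proof
      assume "derivable \<Sigma> (\<Union>\<C>) \<phi>"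
      then obtain A where A: "finite A" "A \<subseteq> \<Union>\<C>" "\<Sigma> \<turnstile>\<^sub>g (Conj_set A \<^bold>\<rightarrow> \<phi>)"
        unfolding derivable_def by blast
      then obtain x where "x \<in> \<C>" "A \<subseteq> x"
        using finite_subset_Union_chain[OF A(1,2) C] by blast
      then have "derivable \<Sigma> x \<phi>" "x \<in> S"
        using A C by (auto simp: derivable_def subset.chain_def)
      then show False
        by (simp add: S_def)
    qed
    moreover have "\<Gamma> \<subseteq> \<Union>\<C>"
      using C unfolding S_def subset.chain_def by blast
    ultimately show "\<Union>\<C> \<in> S"
      by (simp add: S_def)
  qed
  then obtain x where x: "x \<in> S" "\<And>y. y \<in> S \<Longrightarrow> x \<subseteq> y \<Longrightarrow> y = x"
    by blast
  have "x \<in> points \<Sigma>"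
  proof (rule maximal_underivable_is_point)
    show "\<not> derivable \<Sigma> x \<phi>"
      using x by (simp add: S_def)
    fix \<psi> assume "\<psi> \<notin> x"
    then have "insert \<psi> x \<notin> S"
      using x(2)[of "insert \<psi> x"] by blast
    then show "derivable \<Sigma> (insert \<psi> x) \<phi>"
      using x(1) by (auto simp: S_def)
  qed
  then show thesis
    using that x(1) derivable_hypothesis by (auto simp: S_def)
qed

text \<open>Completeness for the propositional part: modal formulas are evaluated as atoms, subject only to
  the theorems of \<open>\<Sigma>\<close>.\<close>

theorem derivable_iff_points:
  "derivable \<Sigma> \<Gamma> \<phi> \<longleftrightarrow> (\<forall>x\<in>points \<Sigma>. \<Gamma> \<subseteq> x \<longrightarrow> \<phi> \<in> x)"
proof
  assume "derivable \<Sigma> \<Gamma> \<phi>"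
  then obtain A where A: "finite A" "A \<subseteq> \<Gamma>" "\<Sigma> \<turnstile>\<^sub>g (Conj_set A \<^bold>\<rightarrow> \<phi>)"
    unfolding derivable_def by blast
  show "\<forall>x\<in>points \<Sigma>. \<Gamma> \<subseteq> x \<longrightarrow> \<phi> \<in> x"
  proof (intro ballI impI)
    fix x assume x: "x \<in> points \<Sigma>" "\<Gamma> \<subseteq> x"
    show "\<phi> \<in> x"
      using points_theorem[OF x(1) A(3)] A x by (auto simp: points_mem)
  qed
next
  assume "\<forall>x\<in>points \<Sigma>. \<Gamma> \<subseteq> x \<longrightarrow> \<phi> \<in> x"
  then show "derivable \<Sigma> \<Gamma> \<phi>"
    by (metis point_extending_exists)
qed

definition truth_set :: "'i::finite fm set \<Rightarrow> 'i fm \<Rightarrow> 'i fm set set" where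
  "truth_set \<Sigma> \<phi> = {x \<in> points \<Sigma>. \<phi> \<in> x}"

lemma derivable_g_iff_points: "\<Sigma> \<turnstile>\<^sub>g \<phi> \<longleftrightarrow> (\<forall>x\<in>points \<Sigma>. \<phi> \<in> x)"
proof -
  have "\<Sigma> \<turnstile>\<^sub>g \<phi>" if "\<Sigma> \<turnstile>\<^sub>g (Conj_set {} \<^bold>\<rightarrow> \<phi>)"
    by (rule derivable_g_tautological_consequence[OF that])
      (simp add: tautology_iff truth_assignment_simps)
  then have "derivable \<Sigma> {} \<phi> \<longleftrightarrow> \<Sigma> \<turnstile>\<^sub>g \<phi>"
    using derivable_theorem[of \<Sigma> \<phi> "{}"] unfolding derivable_def by auto
  then show ?thesis
    using derivable_iff_points[of \<Sigma> "{}" \<phi>] by simp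
qed

lemma truth_set_subset_iff: "truth_set \<Sigma> \<phi> \<subseteq> truth_set \<Sigma> \<psi> \<longleftrightarrow> \<Sigma> \<turnstile>\<^sub>g (\<phi> \<^bold>\<rightarrow> \<psi>)"
  by (auto simp: derivable_g_iff_points truth_set_def points_mem)

lemma truth_set_subset_points: "truth_set \<Sigma> \<phi> \<subseteq> points \<Sigma>"
  by (auto simp: truth_set_def)

lemma truth_set_connectives:
  "truth_set \<Sigma> Bot = {}"
  "truth_set \<Sigma> Top = points \<Sigma>"
  "truth_set \<Sigma> (\<phi> \<^bold>\<rightarrow> \<psi>) = truth_set \<Sigma> \<psi> \<union> (points \<Sigma> - truth_set \<Sigma> \<phi>)"
  "truth_set \<Sigma> (Neg \<phi>) = points \<Sigma> - truth_set \<Sigma> \<phi>"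
  "truth_set \<Sigma> (\<phi> \<^bold>\<and> \<psi>) = truth_set \<Sigma> \<phi> \<inter> truth_set \<Sigma> \<psi>"
  "truth_set \<Sigma> (Ev \<phi>) = (\<Inter>i. truth_set \<Sigma> (Box i \<phi>))"
  by (auto simp: truth_set_def points_mem)

lemma truth_set_modality:
  assumes "S4_modality \<Sigma> M"
  shows truth_set_modality_mono:
      "truth_set \<Sigma> \<phi> \<subseteq> truth_set \<Sigma> \<psi> \<Longrightarrow> truth_set \<Sigma> (M \<phi>) \<subseteq> truth_set \<Sigma> (M \<psi>)"
    and truth_set_modality_deflationary: "truth_set \<Sigma> (M \<phi>) \<subseteq> truth_set \<Sigma> \<phi>"
    and truth_set_modality_idem: "truth_set \<Sigma> (M (M \<phi>)) = truth_set \<Sigma> (M \<phi>)"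
    and truth_set_modality_Top: "truth_set \<Sigma> (M Top) = points \<Sigma>"
    and truth_set_modality_Conj:
      "truth_set \<Sigma> (M (\<phi> \<^bold>\<and> \<psi>)) = truth_set \<Sigma> (M \<phi>) \<inter> truth_set \<Sigma> (M \<psi>)"
proof -
  have K: "\<Sigma> \<turnstile>\<^sub>g (M (\<phi> \<^bold>\<rightarrow> \<psi>) \<^bold>\<rightarrow> (M \<phi> \<^bold>\<rightarrow> M \<psi>))" for \<phi> \<psi>
    using assms by (simp add: S4_modality_def)
  have nec: "\<Sigma> \<turnstile>\<^sub>g \<phi> \<Longrightarrow> \<Sigma> \<turnstile>\<^sub>g M \<phi>" for \<phi>
    using assms by (simp add: S4_modality_def)
  show mono: "truth_set \<Sigma> \<phi> \<subseteq> truth_set \<Sigma> \<psi> \<Longrightarrow> truth_set \<Sigma> (M \<phi>) \<subseteq> truth_set \<Sigma> (M \<psi>)" for \<phi> \<psi>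
    unfolding truth_set_subset_iff using K nec derivable_g_mp by blast
  show T: "truth_set \<Sigma> (M \<phi>) \<subseteq> truth_set \<Sigma> \<phi>" for \<phi>
    using assms by (simp add: truth_set_subset_iff S4_modality_def)
  show "truth_set \<Sigma> (M (M \<phi>)) = truth_set \<Sigma> (M \<phi>)"
    using assms T[of "M \<phi>"] by (simp add: set_eq_subset truth_set_subset_iff S4_modality_def)
  have "\<Sigma> \<turnstile>\<^sub>g Top"
    by (simp add: derivable_g_iff_points points_mem)
  then show "truth_set \<Sigma> (M Top) = points \<Sigma>"
    using nec by (auto simp: truth_set_def points_theorem)
  have "truth_set \<Sigma> (M \<phi>) \<inter> truth_set \<Sigma> (M \<psi>) \<subseteq> truth_set \<Sigma> (M (\<phi> \<^bold>\<and> \<psi>))"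
  proof -
    have "truth_set \<Sigma> (M \<phi>) \<subseteq> truth_set \<Sigma> (M (\<psi> \<^bold>\<rightarrow> (\<phi> \<^bold>\<and> \<psi>)))"
      using truth_set_subset_points[of \<Sigma> \<phi>] by (intro mono) (auto simp: truth_set_connectives)
    moreover have "truth_set \<Sigma> (M (\<psi> \<^bold>\<rightarrow> (\<phi> \<^bold>\<and> \<psi>))) \<subseteq> truth_set \<Sigma> (M \<psi> \<^bold>\<rightarrow> M (\<phi> \<^bold>\<and> \<psi>))"
      using K by (simp add: truth_set_subset_iff)
    ultimately show ?thesis
      by (auto simp: truth_set_connectives)
  qed
  then show "truth_set \<Sigma> (M (\<phi> \<^bold>\<and> \<psi>)) = truth_set \<Sigma> (M \<phi>) \<inter> truth_set \<Sigma> (M \<psi>)"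
    using mono[of "\<phi> \<^bold>\<and> \<psi>" \<phi>] mono[of "\<phi> \<^bold>\<and> \<psi>" \<psi>] by (auto simp: truth_set_connectives)
qed

text \<open>The \<open>\<omega>\<close>-rule in terms of truth sets. Both completeness theorems depend on the \<open>\<omega>\<close>-rule only
  through this lemma.\<close>

lemma truth_set_omega:
  assumes "\<And>j. truth_set \<Sigma> (a j) \<subseteq> truth_set \<Sigma> (Ev \<psi>) \<inter> truth_set \<Sigma> (Ev (a (Suc j)))"
  shows "truth_set \<Sigma> (a 0) \<subseteq> truth_set \<Sigma> (Com \<psi>)"
proof -
  have "\<Sigma> \<turnstile>\<^sub>g (a j \<^bold>\<rightarrow> (Ev \<psi> \<^bold>\<and> Ev (a (Suc j))))" for j
    using assms[of j] by (simp add: truth_set_connectives(5) flip: truth_set_subset_iff)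
  then show ?thesis
    unfolding truth_set_subset_iff by (rule derivable_g_omega)
qed

section \<open>Topologies on the points\<close>

text \<open>Compactness of the Stone space. A cover of the truth set of \<open>\<phi>\<close> says that \<open>Neg \<phi>\<close> holds at all
  points containing the negations of the cover, hence is derivable from finitely many of them.\<close>

lemma truth_set_compact:
  assumes "truth_set \<Sigma> \<phi> \<subseteq> (\<Union>\<psi>\<in>B. truth_set \<Sigma> \<psi>)"
  obtains B0 where "finite B0" "B0 \<subseteq> B" "truth_set \<Sigma> \<phi> \<subseteq> (\<Union>\<psi>\<in>B0. truth_set \<Sigma> \<psi>)"
proof -
  have "derivable \<Sigma> (Neg ` B) (Neg \<phi>)"
    unfolding derivable_iff_points using assms by (fastforce simp: truth_set_def points_mem)
  then obtain A where A: "finite A" "A \<subseteq> Neg ` B" "\<Sigma> \<turnstile>\<^sub>g (Conj_set A \<^bold>\<rightarrow> Neg \<phi>)"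
    unfolding derivable_def by blast
  then obtain B0 where B0: "B0 \<subseteq> B" "finite B0" "A = Neg ` B0"
    by (meson finite_subset_image)
  have "truth_set \<Sigma> \<phi> \<subseteq> (\<Union>\<psi>\<in>B0. truth_set \<Sigma> \<psi>)"
    using A(3) B0 by (fastforce simp: truth_set_def derivable_g_iff_points points_mem)
  then show thesis
    using that B0 by blast
qed

definition Disj_set :: "'i fm set \<Rightarrow> 'i fm" where
  "Disj_set S = Neg (Conj_set (Neg ` S))"

lemma truth_set_Disj_set: "finite S \<Longrightarrow> truth_set \<Sigma> (Disj_set S) = (\<Union>\<psi>\<in>S. truth_set \<Sigma> \<psi>)"
  by (auto simp: Disj_set_def truth_set_def points_mem image_subset_iff)

text \<open>The topology that has the truth sets of the formulas \<open>Box i \<psi>\<close> as a base.\<close>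

definition canonical_topology :: "'i::finite fm set \<Rightarrow> 'i \<Rightarrow> 'i fm set topology" where
  "canonical_topology \<Sigma> i = topology (\<lambda>U. U \<subseteq> points \<Sigma> \<and>
     (\<forall>x\<in>U. \<exists>\<psi>. x \<in> truth_set \<Sigma> (Box i \<psi>) \<and> truth_set \<Sigma> (Box i \<psi>) \<subseteq> U))"

lemma openin_canonical_topology:
  "openin (canonical_topology \<Sigma> i) U \<longleftrightarrow> U \<subseteq> points \<Sigma> \<and>
     (\<forall>x\<in>U. \<exists>\<psi>. x \<in> truth_set \<Sigma> (Box i \<psi>) \<and> truth_set \<Sigma> (Box i \<psi>) \<subseteq> U)"
proof -
  have "istopology (\<lambda>U. U \<subseteq> points \<Sigma> \<and>
     (\<forall>x\<in>U. \<exists>\<psi>. x \<in> truth_set \<Sigma> (Box i \<psi>) \<and> truth_set \<Sigma> (Box i \<psi>) \<subseteq> U))"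
    unfolding istopology_def
  proof (intro conjI allI impI)
    fix S T
    assume S: "S \<subseteq> points \<Sigma> \<and> (\<forall>x\<in>S. \<exists>\<psi>. x \<in> truth_set \<Sigma> (Box i \<psi>) \<and> truth_set \<Sigma> (Box i \<psi>) \<subseteq> S)"
      and T: "T \<subseteq> points \<Sigma> \<and> (\<forall>x\<in>T. \<exists>\<psi>. x \<in> truth_set \<Sigma> (Box i \<psi>) \<and> truth_set \<Sigma> (Box i \<psi>) \<subseteq> T)"
    show "S \<inter> T \<subseteq> points \<Sigma>"
      using S by blast
    show "\<forall>x\<in>S \<inter> T. \<exists>\<psi>. x \<in> truth_set \<Sigma> (Box i \<psi>) \<and> truth_set \<Sigma> (Box i \<psi>) \<subseteq> S \<inter> T"
    proof
      fix x assume "x \<in> S \<inter> T"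
      then obtain \<psi> \<chi> where "x \<in> truth_set \<Sigma> (Box i \<psi>)" "truth_set \<Sigma> (Box i \<psi>) \<subseteq> S"
        "x \<in> truth_set \<Sigma> (Box i \<chi>)" "truth_set \<Sigma> (Box i \<chi>) \<subseteq> T"
        using S T by blast
      then show "\<exists>\<psi>. x \<in> truth_set \<Sigma> (Box i \<psi>) \<and> truth_set \<Sigma> (Box i \<psi>) \<subseteq> S \<inter> T"
        by (intro exI[of _ "\<psi> \<^bold>\<and> \<chi>"]) (auto simp: truth_set_modality_Conj[OF S4_modality_Box])
    qed
  next
    fix \<K>
    assume K: "\<forall>S\<in>\<K>. S \<subseteq> points \<Sigma> \<and>
      (\<forall>x\<in>S. \<exists>\<psi>. x \<in> truth_set \<Sigma> (Box i \<psi>) \<and> truth_set \<Sigma> (Box i \<psi>) \<subseteq> S)"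
    then show "\<Union>\<K> \<subseteq> points \<Sigma>"
      by blast
    show "\<forall>x\<in>\<Union>\<K>. \<exists>\<psi>. x \<in> truth_set \<Sigma> (Box i \<psi>) \<and> truth_set \<Sigma> (Box i \<psi>) \<subseteq> \<Union>\<K>"
      using K by (meson UnionE Union_upper subset_trans)
  qed
  then show ?thesis
    by (simp add: canonical_topology_def topology_inverse')
qed

lemma topspace_canonical_topology: "topspace (canonical_topology \<Sigma> i) = points \<Sigma>"
proof -
  have "openin (canonical_topology \<Sigma> i) (points \<Sigma>)"
    unfolding openin_canonical_topology
    using truth_set_modality_Top[OF S4_modality_Box, of \<Sigma> i] by blast
  then show ?thesis
    by (metis openin_canonical_topology openin_subset openin_topspace subset_antisym)
qed

lemma openin_canonical_truth_set_Box: "openin (canonical_topology \<Sigma> i) (truth_set \<Sigma> (Box i \<phi>))"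
  unfolding openin_canonical_topology using truth_set_subset_points by blast

text \<open>If a basic set \<open>Box i \<psi>\<close> lies in the truth set of \<open>\<phi>\<close>, monotonicity gives
  \<open>Box i (Box i \<psi>) \<le> Box i \<phi>\<close>, and idempotence removes the double box.\<close>

lemma interior_of_truth_set_Box:
  "canonical_topology \<Sigma> i interior_of truth_set \<Sigma> \<phi> = truth_set \<Sigma> (Box i \<phi>)"
proof (rule interior_of_unique)
  show "truth_set \<Sigma> (Box i \<phi>) \<subseteq> truth_set \<Sigma> \<phi>"
    by (rule truth_set_modality_deflationary[OF S4_modality_Box])
  show "openin (canonical_topology \<Sigma> i) (truth_set \<Sigma> (Box i \<phi>))"
    by (rule openin_canonical_truth_set_Box)
  fix U assume U: "U \<subseteq> truth_set \<Sigma> \<phi>" "openin (canonical_topology \<Sigma> i) U"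
  show "U \<subseteq> truth_set \<Sigma> (Box i \<phi>)"
  proof
    fix x assume "x \<in> U"
    then obtain \<psi> where \<psi>: "x \<in> truth_set \<Sigma> (Box i \<psi>)" "truth_set \<Sigma> (Box i \<psi>) \<subseteq> U"
      using U(2) unfolding openin_canonical_topology by blast
    then have "truth_set \<Sigma> (Box i (Box i \<psi>)) \<subseteq> truth_set \<Sigma> (Box i \<phi>)"
      using U(1) by (intro truth_set_modality_mono[OF S4_modality_Box]) blast
    then show "x \<in> truth_set \<Sigma> (Box i \<phi>)"
      using \<psi>(1) by (auto simp: truth_set_modality_idem[OF S4_modality_Box])
  qed
qed

text \<open>One step of the sequence for the \<open>\<omega>\<close>-rule. Compactness gives finitely many basic sets of each
  topology, all inside \<open>U\<close>, that cover the truth set of \<open>\<phi>\<close>. A single disjunction \<open>\<psi>\<close> over all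
  indices works: each disjunct \<open>Box i \<gamma>\<close> is \<open>Box i (Box i \<gamma>)\<close> and so implies \<open>Box i \<psi>\<close>.\<close>

lemma interpolating_Ev:
  assumes op: "\<And>i. openin (canonical_topology \<Sigma> i) U" and sub: "truth_set \<Sigma> \<phi> \<subseteq> U"
  obtains \<psi> where "truth_set \<Sigma> \<psi> \<subseteq> U" "truth_set \<Sigma> \<phi> \<subseteq> truth_set \<Sigma> (Ev \<psi>)"
proof -
  have "\<exists>G. finite G \<and> (\<forall>\<gamma>\<in>G. truth_set \<Sigma> (Box i \<gamma>) \<subseteq> U) \<and>
      truth_set \<Sigma> \<phi> \<subseteq> (\<Union>\<gamma>\<in>G. truth_set \<Sigma> (Box i \<gamma>))" for i
  proof -
    let ?B = "Box i ` {\<gamma>. truth_set \<Sigma> (Box i \<gamma>) \<subseteq> U}"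
    have "truth_set \<Sigma> \<phi> \<subseteq> (\<Union>\<psi>\<in>?B. truth_set \<Sigma> \<psi>)"
      using sub op[of i] unfolding openin_canonical_topology by blast
    then obtain B0 where "finite B0" "B0 \<subseteq> ?B" "truth_set \<Sigma> \<phi> \<subseteq> (\<Union>\<psi>\<in>B0. truth_set \<Sigma> \<psi>)"
      by (rule truth_set_compact)
    moreover then obtain G where "G \<subseteq> {\<gamma>. truth_set \<Sigma> (Box i \<gamma>) \<subseteq> U}" "finite G" "B0 = Box i ` G"
      by (meson finite_subset_image)
    ultimately show ?thesis
      by (intro exI[of _ G]) auto
  qed
  then obtain G where G: "\<And>i. finite (G i)"
    "\<And>i \<gamma>. \<gamma> \<in> G i \<Longrightarrow> truth_set \<Sigma> (Box i \<gamma>) \<subseteq> U"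
    "\<And>i. truth_set \<Sigma> \<phi> \<subseteq> (\<Union>\<gamma>\<in>G i. truth_set \<Sigma> (Box i \<gamma>))"
    by metis
  define \<psi> where "\<psi> = Disj_set (\<Union>i. Box i ` G i)"
  have \<psi>: "truth_set \<Sigma> \<psi> = (\<Union>i. \<Union>\<gamma>\<in>G i. truth_set \<Sigma> (Box i \<gamma>))"
    unfolding \<psi>_def using G(1) by (subst truth_set_Disj_set) auto
  show thesis
  proof (rule that)
    show "truth_set \<Sigma> \<psi> \<subseteq> U"
      using G(2) unfolding \<psi> by blast
    have "truth_set \<Sigma> (Box i \<gamma>) \<subseteq> truth_set \<Sigma> (Box i \<psi>)" if "\<gamma> \<in> G i" for i \<gamma>
      using truth_set_modality_mono[OF S4_modality_Box, of \<Sigma> "Box i \<gamma>" \<psi> i] that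
      unfolding truth_set_modality_idem[OF S4_modality_Box] \<psi> by blast
    then show "truth_set \<Sigma> \<phi> \<subseteq> truth_set \<Sigma> (Ev \<psi>)"
      using G(3) unfolding truth_set_connectives by blast
  qed
qed

lemma truth_set_Com_subset:
  "truth_set \<Sigma> (Com \<phi>) \<subseteq> truth_set \<Sigma> (Ev \<phi>)"
  "truth_set \<Sigma> (Com \<phi>) \<subseteq> truth_set \<Sigma> (Ev (Com \<phi>))"
proof -
  have "truth_set \<Sigma> (Com \<phi>) \<subseteq> truth_set \<Sigma> (Ev \<phi> \<^bold>\<and> Ev (Com \<phi>))"
    unfolding truth_set_subset_iff by (rule derivable_g_axiom[OF com_mix])
  then show "truth_set \<Sigma> (Com \<phi>) \<subseteq> truth_set \<Sigma> (Ev \<phi>)"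
    "truth_set \<Sigma> (Com \<phi>) \<subseteq> truth_set \<Sigma> (Ev (Com \<phi>))"
    unfolding truth_set_connectives(5) by blast+
qed

text \<open>The set \<open>Com \<phi>\<close> is open in every canonical topology since \<open>Com \<phi>\<close> implies \<open>Box i (Com \<phi>)\<close>. That
  it is the largest such set inside \<open>\<phi>\<close> is where the \<open>\<omega>\<close>-rule is needed.\<close>

lemma interior_of_truth_set_Com:
  "inter_topology (canonical_topology \<Sigma>) interior_of truth_set \<Sigma> \<phi> = truth_set \<Sigma> (Com \<phi>)"
proof (rule interior_of_unique)
  show "truth_set \<Sigma> (Com \<phi>) \<subseteq> truth_set \<Sigma> \<phi>"
    by (rule truth_set_modality_deflationary[OF S4_modality_Com])
  have "truth_set \<Sigma> (Com \<phi>) = truth_set \<Sigma> (Box i (Com \<phi>))" for i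
    using truth_set_Com_subset(2)[of \<Sigma> \<phi>] truth_set_modality_deflationary[OF S4_modality_Box, of \<Sigma> i "Com \<phi>"]
    unfolding truth_set_connectives by blast
  then show "openin (inter_topology (canonical_topology \<Sigma>)) (truth_set \<Sigma> (Com \<phi>))"
    unfolding openin_inter_topology by (metis openin_canonical_truth_set_Box)
  fix U assume sub: "U \<subseteq> truth_set \<Sigma> \<phi>" and "openin (inter_topology (canonical_topology \<Sigma>)) U"
  then have op: "openin (canonical_topology \<Sigma> i) U" for i
    by (simp add: openin_inter_topology)
  show "U \<subseteq> truth_set \<Sigma> (Com \<phi>)"
  proof
    fix x assume "x \<in> U"
    \<comment> \<open>A basic neighbourhood for any one index starts the sequence.\<close>
    then obtain \<alpha> where \<alpha>: "x \<in> truth_set \<Sigma> \<alpha>" "truth_set \<Sigma> \<alpha> \<subseteq> U"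
      using op[of undefined] unfolding openin_canonical_topology by blast
    have "\<exists>a. \<forall>j. (truth_set \<Sigma> (a j) \<subseteq> U \<and> (j = 0 \<longrightarrow> a j = \<alpha>)) \<and>
        truth_set \<Sigma> (a j) \<subseteq> truth_set \<Sigma> (Ev (a (Suc j)))"
      using \<alpha>(2) by (intro dependent_nat_choice) (auto elim: interpolating_Ev[OF op])
    then obtain a where a: "\<And>j. truth_set \<Sigma> (a j) \<subseteq> U" "a 0 = \<alpha>"
      "\<And>j. truth_set \<Sigma> (a j) \<subseteq> truth_set \<Sigma> (Ev (a (Suc j)))"
      by blast
    have "truth_set \<Sigma> (Ev (a (Suc j))) \<subseteq> truth_set \<Sigma> (Ev \<phi>)" for j
      using truth_set_modality_mono[OF S4_modality_Box, of \<Sigma> "a (Suc j)" \<phi>] a(1)[of "Suc j"] sub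
      unfolding truth_set_connectives by blast
    then have "truth_set \<Sigma> (a 0) \<subseteq> truth_set \<Sigma> (Com \<phi>)"
      using a(3) by (intro truth_set_omega) blast
    then show "x \<in> truth_set \<Sigma> (Com \<phi>)"
      using \<alpha>(1) a(2) by blast
  qed
qed

lemma top_model_canonical:
  "top_model (points \<Sigma>) (canonical_topology \<Sigma>) (truth_set \<Sigma>)"
  unfolding top_model_def
  by (simp add: topspace_canonical_topology truth_set_subset_points truth_set_connectives
      interior_of_truth_set_Box interior_of_truth_set_Com)

theorem topological_completeness:
  fixes \<Sigma> :: "'i::finite fm set"
  assumes "top_consequence TYPE('i fm set) \<Sigma> \<Gamma> \<phi>"
  shows "derivable \<Sigma> \<Gamma> \<phi>"
  unfolding derivable_iff_points
proof (intro ballI impI)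
  fix x assume x: "x \<in> points \<Sigma>" "\<Gamma> \<subseteq> x"
  have "truth_set \<Sigma> \<xi> = points \<Sigma>" if "\<xi> \<in> \<Sigma>" for \<xi>
    using points_theorem derivable_g_assumption[OF that] by (auto simp: truth_set_def)
  moreover have "x \<in> truth_set \<Sigma> \<psi>" if "\<psi> \<in> \<Gamma>" for \<psi>
    using x that by (auto simp: truth_set_def)
  ultimately have "x \<in> truth_set \<Sigma> \<phi>"
    using assms x(1) top_model_canonical[of \<Sigma>] unfolding top_consequence_def by blast
  then show "\<phi> \<in> x"
    by (simp add: truth_set_def)
qed

section \<open>The Lindenbaum algebra\<close>

definition truth_class :: "'i::finite fm set \<Rightarrow> 'i fm \<Rightarrow> 'i fm set" where
  "truth_class \<Sigma> \<phi> = {\<psi>. truth_set \<Sigma> \<psi> = truth_set \<Sigma> \<phi>}"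

text \<open>The operations act on arbitrary representatives; that the choice does not matter is
  \<open>lindenbaum_algebra_simps\<close>. Classes of formulas with the same truth set are the classes of provable
  equivalence, by \<open>truth_set_subset_iff\<close>.\<close>

definition lindenbaum_algebra :: "'i::finite fm set \<Rightarrow> ('i, 'i fm set) s4c_alg" where
  "lindenbaum_algebra \<Sigma> =
    (let rep = (\<lambda>c. SOME \<phi>. \<phi> \<in> c) in
     \<lparr>carr = range (truth_class \<Sigma>),
      meet = (\<lambda>a b. truth_class \<Sigma> (rep a \<^bold>\<and> rep b)),
      join = (\<lambda>a b. truth_class \<Sigma> (Neg (rep a) \<^bold>\<rightarrow> rep b)),
      compl = (\<lambda>a. truth_class \<Sigma> (Neg (rep a))),
      zero = truth_class \<Sigma> Bot,
      one = truth_class \<Sigma> Top,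
      box = (\<lambda>i a. truth_class \<Sigma> (Box i (rep a))),
      com = (\<lambda>a. truth_class \<Sigma> (Com (rep a)))\<rparr>)"

lemma truth_class_eq_iff: "truth_class \<Sigma> \<phi> = truth_class \<Sigma> \<psi> \<longleftrightarrow> truth_set \<Sigma> \<phi> = truth_set \<Sigma> \<psi>"
  by (auto simp: truth_class_def)

lemma truth_set_some_truth_class:
  "truth_set \<Sigma> (SOME \<psi>. \<psi> \<in> truth_class \<Sigma> \<phi>) = truth_set \<Sigma> \<phi>"
proof -
  have "(SOME \<psi>. \<psi> \<in> truth_class \<Sigma> \<phi>) \<in> truth_class \<Sigma> \<phi>"
    by (rule someI[of _ \<phi>]) (simp add: truth_class_def)
  then show ?thesis
    by (simp add: truth_class_def)
qed

lemma truth_set_modality_cong: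
  "S4_modality \<Sigma> M \<Longrightarrow> truth_set \<Sigma> \<phi> = truth_set \<Sigma> \<psi> \<Longrightarrow> truth_set \<Sigma> (M \<phi>) = truth_set \<Sigma> (M \<psi>)"
  by (simp add: set_eq_subset truth_set_modality_mono)

lemma lindenbaum_algebra_simps:
  "carr (lindenbaum_algebra \<Sigma>) = range (truth_class \<Sigma>)"
  "zero (lindenbaum_algebra \<Sigma>) = truth_class \<Sigma> Bot"
  "one (lindenbaum_algebra \<Sigma>) = truth_class \<Sigma> Top"
  "meet (lindenbaum_algebra \<Sigma>) (truth_class \<Sigma> \<phi>) (truth_class \<Sigma> \<psi>) = truth_class \<Sigma> (\<phi> \<^bold>\<and> \<psi>)"
  "join (lindenbaum_algebra \<Sigma>) (truth_class \<Sigma> \<phi>) (truth_class \<Sigma> \<psi>) = truth_class \<Sigma> (Neg \<phi> \<^bold>\<rightarrow> \<psi>)"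
  "compl (lindenbaum_algebra \<Sigma>) (truth_class \<Sigma> \<phi>) = truth_class \<Sigma> (Neg \<phi>)"
  "box (lindenbaum_algebra \<Sigma>) i (truth_class \<Sigma> \<phi>) = truth_class \<Sigma> (Box i \<phi>)"
  "com (lindenbaum_algebra \<Sigma>) (truth_class \<Sigma> \<phi>) = truth_class \<Sigma> (Com \<phi>)"
  by (simp_all add: lindenbaum_algebra_def Let_def truth_class_eq_iff truth_set_connectives
      truth_set_some_truth_class truth_set_modality_cong[OF S4_modality_Box truth_set_some_truth_class]
      truth_set_modality_cong[OF S4_modality_Com truth_set_some_truth_class])

lemma lindenbaum_leq:
  "leq (lindenbaum_algebra \<Sigma>) (truth_class \<Sigma> \<phi>) (truth_class \<Sigma> \<psi>) \<longleftrightarrow>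
    truth_set \<Sigma> \<phi> \<subseteq> truth_set \<Sigma> \<psi>"
  by (auto simp: leq_def lindenbaum_algebra_simps truth_class_eq_iff truth_set_connectives)

lemma lindenbaum_imp:
  "imp (lindenbaum_algebra \<Sigma>) (truth_class \<Sigma> \<phi>) (truth_class \<Sigma> \<psi>) = truth_class \<Sigma> (\<phi> \<^bold>\<rightarrow> \<psi>)"
  using truth_set_subset_points[of \<Sigma> \<phi>] truth_set_subset_points[of \<Sigma> \<psi>]
  by (auto simp: imp_def lindenbaum_algebra_simps truth_class_eq_iff truth_set_connectives)

text \<open>\<open>ev\<close> folds down to the unit, while \<open>Ev\<close> ends in its last conjunct, so the two
  are compared through truth sets.\<close>

lemma lindenbaum_ev:
  fixes \<Sigma> :: "'i::finite fm set"
  shows "ev (lindenbaum_algebra \<Sigma>) (truth_class \<Sigma> \<phi>) = truth_class \<Sigma> (Ev \<phi>)"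
proof -
  let ?A = "lindenbaum_algebra \<Sigma>"
  have "\<exists>\<psi>. foldr (meet ?A) (map (\<lambda>i. box ?A i (truth_class \<Sigma> \<phi>)) is) (one ?A) = truth_class \<Sigma> \<psi> \<and>
      truth_set \<Sigma> \<psi> = points \<Sigma> \<inter> (\<Inter>i\<in>set is. truth_set \<Sigma> (Box i \<phi>))" for "is" :: "'i list"
  proof (induction "is")
    case Nil
    show ?case
      by (rule exI[of _ Top]) (simp add: lindenbaum_algebra_simps truth_set_connectives)
  next
    case (Cons i "is")
    then obtain \<psi> where "foldr (meet ?A) (map (\<lambda>i. box ?A i (truth_class \<Sigma> \<phi>)) is) (one ?A) = truth_class \<Sigma> \<psi>"
      "truth_set \<Sigma> \<psi> = points \<Sigma> \<inter> (\<Inter>i\<in>set is. truth_set \<Sigma> (Box i \<phi>))"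
      by blast
    then show ?case
      by (intro exI[of _ "Box i \<phi> \<^bold>\<and> \<psi>"]) (auto simp: lindenbaum_algebra_simps truth_set_connectives)
  qed
  from this[of "list_of UNIV"] obtain \<psi> where "ev ?A (truth_class \<Sigma> \<phi>) = truth_class \<Sigma> \<psi>"
    "truth_set \<Sigma> \<psi> = points \<Sigma> \<inter> (\<Inter>i. truth_set \<Sigma> (Box i \<phi>))"
    using list_of[of "UNIV :: 'i set"] by (auto simp: ev_def)
  moreover have "points \<Sigma> \<inter> (\<Inter>i. truth_set \<Sigma> (Box i \<phi>)) = truth_set \<Sigma> (Ev \<phi>)"
    unfolding truth_set_connectives using truth_set_subset_points[of \<Sigma>] by blast
  ultimately show ?thesis
    by (simp add: truth_class_eq_iff)
qed

lemma boolean_alg_lindenbaum: "boolean_alg (lindenbaum_algebra \<Sigma>)"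
proof -
  note sub = truth_set_subset_points[of \<Sigma>]
  show ?thesis
    using sub
    by (auto simp: boolean_alg_def lindenbaum_algebra_simps truth_class_eq_iff truth_set_connectives)
qed

lemma interior_alg_lindenbaum:
  assumes "S4_modality \<Sigma> M"
    and f: "\<And>\<phi>. f (truth_class \<Sigma> \<phi>) = truth_class \<Sigma> (M \<phi>)"
  shows "interior_alg (lindenbaum_algebra \<Sigma>) f"
  using truth_set_modality[OF assms(1)]
  by (auto simp: interior_alg_def boolean_alg_lindenbaum lindenbaum_algebra_simps f
      lindenbaum_leq truth_class_eq_iff truth_set_connectives)

lemma S4C_algebra_lindenbaum: "S4C_algebra (lindenbaum_algebra \<Sigma>)"
proof -
  have "truth_set \<Sigma> (Ev \<phi> \<^bold>\<and> Com (\<phi> \<^bold>\<rightarrow> Ev \<phi>)) \<subseteq> truth_set \<Sigma> (Com \<phi>)" for \<phi>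
    unfolding truth_set_subset_iff by (rule derivable_g_axiom[OF com_ind])
  then show ?thesis
    using truth_set_Com_subset[of \<Sigma>]
    by (auto simp: S4C_algebra_def boolean_alg_lindenbaum interior_alg_lindenbaum[OF S4_modality_Box]
        interior_alg_lindenbaum[OF S4_modality_Com] lindenbaum_algebra_simps lindenbaum_ev
        lindenbaum_imp lindenbaum_leq truth_set_connectives(5))
qed

lemma standard_lindenbaum: "standard (lindenbaum_algebra \<Sigma>)"
  unfolding standard_def
proof (intro ballI allI impI)
  fix d and a :: "nat \<Rightarrow> 'a fm set"
  let ?A = "lindenbaum_algebra \<Sigma>"
  assume "d \<in> carr ?A"
    and a: "(\<forall>j. a j \<in> carr ?A) \<and> (\<forall>j. leq ?A (a j) (meet ?A (ev ?A d) (ev ?A (a (Suc j)))))"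
  then obtain \<delta> where d: "d = truth_class \<Sigma> \<delta>"
    by (auto simp: lindenbaum_algebra_simps)
  have "\<exists>\<alpha>. \<forall>j. a j = truth_class \<Sigma> (\<alpha> j)"
    using a by (intro choice) (auto simp: lindenbaum_algebra_simps image_iff)
  then obtain \<alpha> where \<alpha>: "\<And>j. a j = truth_class \<Sigma> (\<alpha> j)"
    by blast
  have "truth_set \<Sigma> (\<alpha> 0) \<subseteq> truth_set \<Sigma> (Com \<delta>)"
    using a by (intro truth_set_omega)
      (simp add: d \<alpha> lindenbaum_ev lindenbaum_algebra_simps lindenbaum_leq truth_set_connectives(5))
  then show "leq ?A (a 0) (com ?A d)"
    by (simp add: d \<alpha> lindenbaum_algebra_simps lindenbaum_leq)
qed

lemma alg_valuation_lindenbaum: "alg_valuation (lindenbaum_algebra \<Sigma>) (truth_class \<Sigma>)"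
  by (simp add: alg_valuation_def lindenbaum_imp lindenbaum_algebra_simps)

text \<open>The classes of the formulas derivable from \<open>\<Gamma>\<close> form a filter that includes the classes of \<open>\<Gamma>\<close>,
  so the generated filter can contain the class of \<open>\<phi>\<close> only if \<open>\<phi>\<close> is derivable.\<close>

theorem algebraic_completeness:
  fixes \<Sigma> :: "'i::finite fm set"
  assumes "alg_consequence TYPE('i fm set) \<Sigma> \<Gamma> \<phi>"
  shows "derivable \<Sigma> \<Gamma> \<phi>"
proof -
  let ?A = "lindenbaum_algebra \<Sigma>"
  define F where "F = truth_class \<Sigma> ` {\<psi>. derivable \<Sigma> \<Gamma> \<psi>}"
  have F_iff: "truth_class \<Sigma> \<psi> \<in> F \<longleftrightarrow> derivable \<Sigma> \<Gamma> \<psi>" for \<psi>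
  proof
    assume "truth_class \<Sigma> \<psi> \<in> F"
    then obtain \<chi> where "truth_set \<Sigma> \<psi> = truth_set \<Sigma> \<chi>" "derivable \<Sigma> \<Gamma> \<chi>"
      by (auto simp: F_def truth_class_eq_iff)
    then show "derivable \<Sigma> \<Gamma> \<psi>"
      unfolding derivable_iff_points truth_set_def by blast
  qed (auto simp: F_def)
  have "derivable \<Sigma> \<Gamma> \<psi>" if "derivable \<Sigma> \<Gamma> \<chi>" "truth_set \<Sigma> \<chi> \<subseteq> truth_set \<Sigma> \<psi>" for \<psi> \<chi>
    using that unfolding derivable_iff_points truth_set_def by blast
  moreover have "F \<subseteq> range (truth_class \<Sigma>)"
    by (auto simp: F_def)
  moreover have "derivable \<Sigma> \<Gamma> Top"
    and "derivable \<Sigma> \<Gamma> \<psi> \<Longrightarrow> derivable \<Sigma> \<Gamma> \<chi> \<Longrightarrow> derivable \<Sigma> \<Gamma> (\<psi> \<^bold>\<and> \<chi>)" for \<psi> \<chi>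
    by (simp_all add: derivable_iff_points points_mem)
  ultimately have "alg_filter ?A F"
    unfolding alg_filter_def F_def
    by (fastforce simp: lindenbaum_leq lindenbaum_algebra_simps)
  moreover have "truth_class \<Sigma> ` \<Gamma> \<subseteq> F"
    using derivable_hypothesis by (auto simp: F_iff)
  moreover have "truth_class \<Sigma> \<phi> \<in> filter_gen ?A (truth_class \<Sigma> ` \<Gamma>)"
  proof -
    have "truth_class \<Sigma> \<xi> = one ?A" if "\<xi> \<in> \<Sigma>" for \<xi>
      using points_theorem derivable_g_assumption[OF that]
      by (auto simp: lindenbaum_algebra_simps truth_class_eq_iff truth_set_def points_mem)
    then show ?thesis
      using assms S4C_algebra_lindenbaum standard_lindenbaum alg_valuation_lindenbaum
      unfolding alg_consequence_def by blast
  qed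
  ultimately show ?thesis
    by (auto simp: filter_gen_def simp flip: F_iff)
qed


section \<open>Ultrafilters of Boolean algebras\<close>

context
  fixes A :: "('a, 'm) bool_alg_scheme"
  assumes A: "boolean_alg A"
begin

text \<open>The laws hold only on the carrier. A few order-theoretic facts are derived from the axioms, just
  enough for the ultrafilter theorem; after that, inequalities and identities are checked by
  membership in ultrafilters.\<close>

lemma carr_closed:
  "zero A \<in> carr A" "one A \<in> carr A" "x \<in> carr A \<Longrightarrow> compl A x \<in> carr A"
  "x \<in> carr A \<Longrightarrow> y \<in> carr A \<Longrightarrow> meet A x y \<in> carr A"
  "x \<in> carr A \<Longrightarrow> y \<in> carr A \<Longrightarrow> join A x y \<in> carr A"
  "x \<in> carr A \<Longrightarrow> y \<in> carr A \<Longrightarrow> imp A x y \<in> carr A"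
  using A by (simp_all add: boolean_alg_def imp_def)

lemma boolean_identities:
  assumes "x \<in> carr A"
  shows "meet A x (one A) = x" "join A x (zero A) = x"
    "meet A x (compl A x) = zero A" "join A x (compl A x) = one A"
  using A assms by (simp_all add: boolean_alg_def)

lemma meet_commute: "x \<in> carr A \<Longrightarrow> y \<in> carr A \<Longrightarrow> meet A x y = meet A y x"
  and join_commute: "x \<in> carr A \<Longrightarrow> y \<in> carr A \<Longrightarrow> join A x y = join A y x"
  using A by (simp_all add: boolean_alg_def)

lemma boolean_distributivity:
  assumes "x \<in> carr A" "y \<in> carr A" "z \<in> carr A"
  shows meet_assoc: "meet A (meet A x y) z = meet A x (meet A y z)"
    and meet_join_distrib: "meet A x (join A y z) = join A (meet A x y) (meet A x z)"
  using A assms unfolding boolean_alg_def by blast+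

lemma meet_idem:
  assumes "x \<in> carr A"
  shows "meet A x x = x"
proof -
  have "meet A x x = join A (meet A x x) (meet A x (compl A x))"
    using assms by (simp add: boolean_identities carr_closed)
  also have "\<dots> = meet A x (join A x (compl A x))"
    using assms by (simp add: meet_join_distrib carr_closed)
  also have "\<dots> = x"
    using assms by (simp add: boolean_identities)
  finally show ?thesis .
qed

lemma leq_refl: "x \<in> carr A \<Longrightarrow> leq A x x"
  by (simp add: leq_def meet_idem)

lemma leq_trans:
  "leq A x y \<Longrightarrow> leq A y z \<Longrightarrow> x \<in> carr A \<Longrightarrow> y \<in> carr A \<Longrightarrow> z \<in> carr A \<Longrightarrow> leq A x z"
  unfolding leq_def by (metis meet_assoc)

lemma leq_antisym: "leq A x y \<Longrightarrow> leq A y x \<Longrightarrow> x \<in> carr A \<Longrightarrow> y \<in> carr A \<Longrightarrow> x = y"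
  unfolding leq_def by (metis meet_commute)

lemma leq_one: "x \<in> carr A \<Longrightarrow> leq A x (one A)"
  by (simp add: leq_def boolean_identities)

lemma meet_leq:
  assumes "x \<in> carr A" "y \<in> carr A"
  shows meet_leq1: "leq A (meet A x y) x" and meet_leq2: "leq A (meet A x y) y"
proof -
  have "leq A (meet A a b) b" if "a \<in> carr A" "b \<in> carr A" for a b
    using that by (simp add: leq_def meet_assoc meet_idem)
  then show "leq A (meet A x y) x" "leq A (meet A x y) y"
    using assms meet_commute by metis+
qed

lemma leq_meet:
  "leq A z x \<Longrightarrow> leq A z y \<Longrightarrow> x \<in> carr A \<Longrightarrow> y \<in> carr A \<Longrightarrow> z \<in> carr A \<Longrightarrow> leq A z (meet A x y)"
  unfolding leq_def by (metis meet_assoc)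

lemma zero_leq: "x \<in> carr A \<Longrightarrow> leq A (zero A) x"
  by (metis boolean_identities(3) carr_closed(3) meet_leq1)

lemma leq_join1:
  assumes "x \<in> carr A" "y \<in> carr A"
  shows "leq A x (join A x y)"
proof -
  have "join A y (one A) = join A y (join A y (compl A y))"
    using assms by (simp add: boolean_identities)
  also have "\<dots> = join A (join A y y) (compl A y)"
    using A assms carr_closed(3) unfolding boolean_alg_def by metis
  also have "join A y y = y"
    using A assms carr_closed(3) unfolding boolean_alg_def by metis
  finally have "join A y (one A) = one A"
    using assms by (simp add: boolean_identities)
  then have "join A x (meet A x y) = x"
    using assms by (metis boolean_identities(1) carr_closed(2) join_commute meet_join_distrib)
  then show ?thesis
    using assms by (simp add: leq_def meet_join_distrib meet_idem)
qed

lemma leq_join2: "x \<in> carr A \<Longrightarrow> y \<in> carr A \<Longrightarrow> leq A y (join A x y)"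
  by (metis leq_join1 join_commute)

lemma leq_by_cases:
  assumes carr: "x \<in> carr A" "y \<in> carr A" "b \<in> carr A"
    and "leq A (meet A x b) y" "leq A (meet A x (compl A b)) y"
  shows "leq A x y"
proof -
  have "meet A x y = meet A y (join A (meet A x b) (meet A x (compl A b)))"
    using carr by (metis boolean_identities carr_closed(3) meet_join_distrib meet_commute)
  also have "\<dots> = join A (meet A x b) (meet A x (compl A b))"
    using assms by (simp add: meet_join_distrib carr_closed leq_def meet_commute[of y])
  also have "\<dots> = x"
    using carr by (metis boolean_identities carr_closed(3) meet_join_distrib)
  finally show ?thesis
    by (simp add: leq_def)
qed

definition ultrafilter :: "'a set \<Rightarrow> bool" where
  "ultrafilter U \<longleftrightarrow> alg_filter A U \<and> zero A \<notin> U \<and> (\<forall>x\<in>carr A. x \<in> U \<or> compl A x \<in> U)"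

lemma ultrafilter_mem:
  assumes U: "ultrafilter U"
  shows "zero A \<notin> U" and "one A \<in> U"
    and "x \<in> carr A \<Longrightarrow> y \<in> carr A \<Longrightarrow> meet A x y \<in> U \<longleftrightarrow> x \<in> U \<and> y \<in> U"
    and "x \<in> carr A \<Longrightarrow> compl A x \<in> U \<longleftrightarrow> x \<notin> U"
    and "x \<in> carr A \<Longrightarrow> y \<in> carr A \<Longrightarrow> join A x y \<in> U \<longleftrightarrow> x \<in> U \<or> y \<in> U"
    and "x \<in> carr A \<Longrightarrow> y \<in> carr A \<Longrightarrow> imp A x y \<in> U \<longleftrightarrow> (x \<in> U \<longrightarrow> y \<in> U)"
proof -
  have filter: "alg_filter A U"
    using U by (simp add: ultrafilter_def)
  have up: "y \<in> U" if "x \<in> U" "leq A x y" "x \<in> carr A" "y \<in> carr A" for x y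
    using filter that unfolding alg_filter_def by blast
  show zero: "zero A \<notin> U" and "one A \<in> U"
    using U by (auto simp: ultrafilter_def alg_filter_def)
  show meet: "meet A x y \<in> U \<longleftrightarrow> x \<in> U \<and> y \<in> U" if "x \<in> carr A" "y \<in> carr A" for x y
    using filter that up meet_leq carr_closed(4) unfolding alg_filter_def by blast
  show compl: "compl A x \<in> U \<longleftrightarrow> x \<notin> U" if "x \<in> carr A" for x
    using U that zero meet[OF that carr_closed(3)[OF that]]
    by (auto simp: ultrafilter_def boolean_identities)
  show join: "join A x y \<in> U \<longleftrightarrow> x \<in> U \<or> y \<in> U" if xy: "x \<in> carr A" "y \<in> carr A" for x y
  proof
    assume *: "join A x y \<in> U"
    have "y \<in> U" if "x \<notin> U"
    proof -
      have "meet A (compl A x) (join A x y) \<in> U"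
        using * that xy by (simp add: meet compl carr_closed)
      also have "meet A (compl A x) (join A x y) = meet A (compl A x) y"
        using xy by (simp add: meet_join_distrib meet_commute[of "compl A x" x]
            join_commute[of "zero A"] boolean_identities carr_closed)
      finally show ?thesis
        using xy by (simp add: meet carr_closed)
    qed
    then show "x \<in> U \<or> y \<in> U"
      by blast
  next
    assume "x \<in> U \<or> y \<in> U"
    then show "join A x y \<in> U"
      using up[OF _ leq_join1[OF xy]] up[OF _ leq_join2[OF xy]] xy carr_closed(5)[OF xy] by blast
  qed
  show "imp A x y \<in> U \<longleftrightarrow> (x \<in> U \<longrightarrow> y \<in> U)" if "x \<in> carr A" "y \<in> carr A"
    using that by (auto simp: imp_def join compl carr_closed)
qed

text \<open>The filter generated by \<open>F\<close> and \<open>b\<close>.\<close>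

lemma alg_filter_extend:
  assumes F: "alg_filter A F" and b: "b \<in> carr A"
  shows "alg_filter A {y \<in> carr A. \<exists>f\<in>F. leq A (meet A f b) y}"
    and "F \<subseteq> {y \<in> carr A. \<exists>f\<in>F. leq A (meet A f b) y}"
    and "b \<in> {y \<in> carr A. \<exists>f\<in>F. leq A (meet A f b) y}"
proof -
  have F_carr: "f \<in> carr A" if "f \<in> F" for f
    using F that by (auto simp: alg_filter_def)
  have one: "one A \<in> F"
    using F by (simp add: alg_filter_def)
  have meet: "\<exists>h\<in>F. leq A (meet A h b) (meet A x y)"
    if f: "f \<in> F" "leq A (meet A f b) x" and g: "g \<in> F" "leq A (meet A g b) y"
      and xy: "x \<in> carr A" "y \<in> carr A" for f g x y
  proof (rule bexI[of _ "meet A f g"])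
    show mem: "meet A f g \<in> F"
      using F f g by (simp add: alg_filter_def)
    have "leq A (meet A (meet A f g) b) (meet A f b)" "leq A (meet A (meet A f g) b) (meet A g b)"
      using f g b F_carr
      by (meson leq_meet meet_leq1 meet_leq2 leq_trans carr_closed(4))+
    then show "leq A (meet A (meet A f g) b) (meet A x y)"
      using f g b xy F_carr by (meson leq_meet leq_trans carr_closed(4))
  qed
  have up: "\<exists>f\<in>F. leq A (meet A f b) y"
    if "f \<in> F" "leq A (meet A f b) x" "leq A x y" "x \<in> carr A" "y \<in> carr A" for f x y
    using that b F_carr by (meson leq_trans carr_closed(4))
  show "alg_filter A {y \<in> carr A. \<exists>f\<in>F. leq A (meet A f b) y}"
    unfolding alg_filter_def
  proof (intro conjI ballI impI)
    show "one A \<in> {y \<in> carr A. \<exists>f\<in>F. leq A (meet A f b) y}"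
      using one b leq_one[OF carr_closed(4)[OF carr_closed(2) b]] carr_closed(2) by blast
  qed (use meet up in \<open>blast intro: carr_closed\<close>)+
  show "F \<subseteq> {y \<in> carr A. \<exists>f\<in>F. leq A (meet A f b) y}"
    using b F_carr meet_leq1 by blast
  show "b \<in> {y \<in> carr A. \<exists>f\<in>F. leq A (meet A f b) y}"
    using b one meet_leq2 carr_closed(2) by blast
qed

text \<open>A filter that is maximal among those avoiding \<open>a\<close> is an ultrafilter: if it lacked both \<open>b\<close> and the
  complement of \<open>b\<close>, adding either would bring in \<open>a\<close>, and then \<open>a\<close> would already be in it.\<close>

theorem ultrafilter_avoiding:
  assumes "alg_filter A F" "a \<in> carr A" "a \<notin> F"
  obtains U where "ultrafilter U" "F \<subseteq> U" "a \<notin> U"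
proof -
  define S where "S = {G. alg_filter A G \<and> F \<subseteq> G \<and> a \<notin> G}"
  have "\<exists>U\<in>S. \<forall>G\<in>S. U \<subseteq> G \<longrightarrow> G = U"
  proof (rule subset_Zorn_nonempty)
    show "S \<noteq> {}"
      using assms by (auto simp: S_def)
    fix \<C> assume C: "\<C> \<noteq> {}" "subset.chain S \<C>"
    have filter: "alg_filter A G" if "G \<in> \<C>" for G
      using C that by (auto simp: S_def subset.chain_def)
    have "meet A x y \<in> \<Union>\<C>" if xy: "x \<in> \<Union>\<C>" "y \<in> \<Union>\<C>" for x y
    proof -
      obtain G where "G \<in> \<C>" "{x, y} \<subseteq> G"
        using finite_subset_Union_chain[of "{x, y}", OF _ _ C] xy by auto
      then show ?thesis
        using filter[of G] unfolding alg_filter_def by blast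
    qed
    moreover have "\<Union>\<C> \<subseteq> carr A" "one A \<in> \<Union>\<C>"
      using C(1) filter unfolding alg_filter_def by blast+
    moreover have "y \<in> \<Union>\<C>" if "x \<in> \<Union>\<C>" "y \<in> carr A" "leq A x y" for x y
    proof -
      obtain G where "G \<in> \<C>" "x \<in> G"
        using \<open>x \<in> \<Union>\<C>\<close> by blast
      then have "y \<in> G"
        using filter[of G] that(2,3) unfolding alg_filter_def by blast
      then show ?thesis
        using \<open>G \<in> \<C>\<close> by blast
    qed
    ultimately have "alg_filter A (\<Union>\<C>)"
      unfolding alg_filter_def by (intro conjI ballI impI)
    then show "\<Union>\<C> \<in> S"
      using C unfolding S_def subset.chain_def by blast
  qed
  then obtain U where "U \<in> S" and maxS: "\<And>G. G \<in> S \<Longrightarrow> U \<subseteq> G \<Longrightarrow> G = U"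
    by blast
  then have U: "alg_filter A U" "F \<subseteq> U" "a \<notin> U"
    by (auto simp: S_def)
  have max: "G = U" if "alg_filter A G" "U \<subseteq> G" "a \<notin> G" for G
    using that U(2) by (intro maxS) (auto simp: S_def)
  have split: "\<exists>f\<in>U. leq A (meet A f b) a" if "b \<in> carr A" "b \<notin> U" for b
    using max[of "{y \<in> carr A. \<exists>f\<in>U. leq A (meet A f b) y}"] alg_filter_extend[OF U(1) that(1)]
      that(2) by blast
  have U_carr: "f \<in> carr A" if "f \<in> U" for f
    using U(1) that by (auto simp: alg_filter_def)
  have "b \<in> U \<or> compl A b \<in> U" if b: "b \<in> carr A" for b
  proof (rule ccontr)
    assume "\<not> (b \<in> U \<or> compl A b \<in> U)"
    then obtain f g where f: "f \<in> U" "leq A (meet A f b) a"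
      and g: "g \<in> U" "leq A (meet A g (compl A b)) a"
      using split[of b] split[of "compl A b"] b carr_closed(3) by blast
    have mem: "meet A f g \<in> U"
      using U(1) f g by (simp add: alg_filter_def)
    have "leq A (meet A f g) a"
    proof (rule leq_by_cases)
      have "leq A (meet A (meet A f g) b) (meet A f b)"
        "leq A (meet A (meet A f g) (compl A b)) (meet A g (compl A b))"
        using f g b U_carr
        by (meson leq_meet meet_leq1 meet_leq2 leq_trans carr_closed(3,4))+
      then show "leq A (meet A (meet A f g) b) a" "leq A (meet A (meet A f g) (compl A b)) a"
        using f g b assms(2) U_carr by (meson leq_trans carr_closed(3,4))+
    qed (use mem U_carr assms(2) b in auto)
    then have "a \<in> U"
      using mem U(1) assms(2) unfolding alg_filter_def by blast
    then show False
      using U(3) by blast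
  qed
  moreover have "zero A \<notin> U"
    using U(1,3) assms(2) zero_leq unfolding alg_filter_def by blast
  ultimately have "ultrafilter U"
    using U(1) by (simp add: ultrafilter_def)
  then show thesis
    using that U by blast
qed

lemma leq_iff_ultrafilters:
  assumes "a \<in> carr A" "b \<in> carr A"
  shows "leq A a b \<longleftrightarrow> (\<forall>U. ultrafilter U \<longrightarrow> a \<in> U \<longrightarrow> b \<in> U)"
proof
  assume "leq A a b"
  then show "\<forall>U. ultrafilter U \<longrightarrow> a \<in> U \<longrightarrow> b \<in> U"
    using assms by (auto simp: ultrafilter_def alg_filter_def)
next
  assume *: "\<forall>U. ultrafilter U \<longrightarrow> a \<in> U \<longrightarrow> b \<in> U"
  have "alg_filter A {y \<in> carr A. leq A a y}"
    using assms(1) leq_trans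
    by (auto simp: alg_filter_def carr_closed intro: leq_one leq_meet)
  then show "leq A a b"
    using * ultrafilter_avoiding[of "{y \<in> carr A. leq A a y}" b] assms leq_refl[OF assms(1)]
    by blast
qed

lemma eq_iff_ultrafilters:
  assumes "a \<in> carr A" "b \<in> carr A"
  shows "a = b \<longleftrightarrow> (\<forall>U. ultrafilter U \<longrightarrow> (a \<in> U \<longleftrightarrow> b \<in> U))"
  using leq_antisym[OF _ _ assms] leq_iff_ultrafilters[OF assms]
    leq_iff_ultrafilters[OF assms(2,1)] by auto

lemma eq_one_iff_ultrafilters:
  assumes "a \<in> carr A"
  shows "a = one A \<longleftrightarrow> (\<forall>U. ultrafilter U \<longrightarrow> a \<in> U)"
  using eq_iff_ultrafilters[OF assms carr_closed(2)] ultrafilter_mem(2) by blast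

lemma imp_eq_one_iff:
  assumes "a \<in> carr A" "b \<in> carr A"
  shows "imp A a b = one A \<longleftrightarrow> leq A a b"
  using assms by (simp add: eq_one_iff_ultrafilters leq_iff_ultrafilters ultrafilter_mem carr_closed)

end

section \<open>Soundness for standard algebras\<close>

lemma interior_alg_mono:
  assumes "interior_alg A f" "leq A a b" "a \<in> carr A" "b \<in> carr A"
  shows "leq A (f a) (f b)"
proof -
  have "f (meet A a b) = meet A (f a) (f b)"
    using assms by (simp add: interior_alg_def)
  then show ?thesis
    using assms(2) by (simp add: leq_def)
qed

text \<open>Multiplicativity turns modus ponens below \<open>f\<close> into the distribution law for implication.\<close>

lemma interior_alg_K:
  assumes f: "interior_alg A f" and ab: "a \<in> carr A" "b \<in> carr A"
  shows "leq A (f (imp A a b)) (imp A (f a) (f b))"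
proof -
  have A: "boolean_alg A" and closed: "\<And>x. x \<in> carr A \<Longrightarrow> f x \<in> carr A"
    using f by (simp_all add: interior_alg_def)
  note simps = leq_iff_ultrafilters[OF A] ultrafilter_mem[OF A] carr_closed[OF A]
  have "leq A (f (meet A (imp A a b) a)) (f b)"
    using ab by (intro interior_alg_mono[OF f]) (auto simp: simps)
  moreover have "f (meet A (imp A a b) a) = meet A (f (imp A a b)) (f a)"
    using f ab by (simp add: interior_alg_def carr_closed[OF A])
  ultimately show ?thesis
    using ab by (auto simp: simps closed)
qed

context
  fixes A :: "('i::finite, 'a) s4c_alg" and v :: "'i fm \<Rightarrow> 'a"
  assumes A: "S4C_algebra A" and v: "alg_valuation A v"
begin

lemma boolean_alg_s4c: "boolean_alg A"
  using A by (simp add: S4C_algebra_def)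

lemma interior_alg_s4c: "interior_alg A (box A i)" "interior_alg A (com A)"
  using A by (simp_all add: S4C_algebra_def)

lemma box_com_closed:
  assumes "x \<in> carr A"
  shows "box A i x \<in> carr A" "com A x \<in> carr A"
  using assms interior_alg_s4c by (simp_all add: interior_alg_def)

lemma valuation_simps:
  "v \<phi> \<in> carr A" "v Bot = zero A" "v (\<phi> \<^bold>\<rightarrow> \<psi>) = imp A (v \<phi>) (v \<psi>)"
  "v (Box i \<phi>) = box A i (v \<phi>)" "v (Com \<phi>) = com A (v \<phi>)"
  using v by (simp_all add: alg_valuation_def)

lemma truth_assignment_ultrafilter:
  "ultrafilter A U \<Longrightarrow> truth_assignment (\<lambda>\<phi>. v \<phi> \<in> U)"
  by (simp add: truth_assignment_def valuation_simps ultrafilter_mem[OF boolean_alg_s4c])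

lemma ev_ultrafilter:
  assumes a: "a \<in> carr A"
  shows ev_closed: "ev A a \<in> carr A"
    and "ultrafilter A U \<Longrightarrow> ev A a \<in> U \<longleftrightarrow> (\<forall>i. box A i a \<in> U)"
proof -
  note B = boolean_alg_s4c
  let ?m = "\<lambda>is. foldr (meet A) (map (\<lambda>i. box A i a) is) (one A)"
  have closed: "?m is \<in> carr A" for "is"
    by (induction "is") (simp_all add: carr_closed[OF B] box_com_closed[OF a])
  then show "ev A a \<in> carr A"
    by (simp add: ev_def)
  assume U: "ultrafilter A U"
  have "?m is \<in> U \<longleftrightarrow> (\<forall>i\<in>set is. box A i a \<in> U)" for "is"
    by (induction "is") (simp_all add: ultrafilter_mem[OF B U] closed box_com_closed[OF a])
  then show "ev A a \<in> U \<longleftrightarrow> (\<forall>i. box A i a \<in> U)"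
    using list_of[of "UNIV :: 'i set"] by (simp add: ev_def)
qed

lemma valuation_Ev: "v (Ev \<phi>) = ev A (v \<phi>)"
  by (simp add: eq_iff_ultrafilters[OF boolean_alg_s4c] valuation_simps ev_ultrafilter
      truth_assignment_simps[OF truth_assignment_ultrafilter])

lemma valuation_Conj: "v (\<phi> \<^bold>\<and> \<psi>) = meet A (v \<phi>) (v \<psi>)"
  by (simp add: eq_iff_ultrafilters[OF boolean_alg_s4c] valuation_simps
      carr_closed[OF boolean_alg_s4c] ultrafilter_mem[OF boolean_alg_s4c]
      truth_assignment_simps[OF truth_assignment_ultrafilter])

lemma valuation_axiom:
  assumes "S4C_axiom \<phi>"
  shows "v \<phi> = one A"
  using assms
proof cases
  case taut
  then show ?thesis
    by (auto simp: eq_one_iff_ultrafilters[OF boolean_alg_s4c] valuation_simps tautology_iff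
        dest: truth_assignment_ultrafilter)
next
  case (box_K i \<psi> \<chi>)
  then show ?thesis
    using interior_alg_K[OF interior_alg_s4c(1)]
    by (simp add: valuation_simps imp_eq_one_iff[OF boolean_alg_s4c] carr_closed[OF boolean_alg_s4c]
        box_com_closed)
next
  case (com_K \<psi> \<chi>)
  then show ?thesis
    using interior_alg_K[OF interior_alg_s4c(2)]
    by (simp add: valuation_simps imp_eq_one_iff[OF boolean_alg_s4c] carr_closed[OF boolean_alg_s4c]
        box_com_closed)
next
  case (box_4 i \<psi>)
  have "leq A (box A i (v \<psi>)) (box A i (box A i (v \<psi>)))"
    using interior_alg_s4c(1)[of i] leq_refl[OF boolean_alg_s4c, of "box A i (v \<psi>)"]
    by (simp add: interior_alg_def valuation_simps)
  with box_4 show ?thesis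
    by (simp add: valuation_simps imp_eq_one_iff[OF boolean_alg_s4c] box_com_closed)
next
  case (box_T i \<psi>)
  then show ?thesis
    using interior_alg_s4c(1)[of i]
    by (simp add: valuation_simps imp_eq_one_iff[OF boolean_alg_s4c] box_com_closed interior_alg_def)
next
  case (com_mix \<psi>)
  then show ?thesis
    using A by (simp add: valuation_simps imp_eq_one_iff[OF boolean_alg_s4c] box_com_closed
        valuation_Conj valuation_Ev ev_closed carr_closed[OF boolean_alg_s4c] S4C_algebra_def)
next
  case (com_ind \<psi>)
  then show ?thesis
    using A by (simp add: valuation_simps imp_eq_one_iff[OF boolean_alg_s4c] box_com_closed
        valuation_Conj valuation_Ev ev_closed carr_closed[OF boolean_alg_s4c] S4C_algebra_def)
qed

text \<open>The necessitation rule is sound only for the value one, which is why the statement is about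
  global derivations; standardness handles the infinitary rule.\<close>

lemma valuation_derivation:
  assumes standard: "standard A" and \<Sigma>: "\<forall>\<xi>\<in>\<Sigma>. v \<xi> = one A"
  shows "omega_derivation d \<Longrightarrow> assumptions d \<subseteq> \<Sigma> \<Longrightarrow> v (root_mark d) = one A"
proof (induction d)
  case (Leaf \<chi>)
  then show ?case
    using \<Sigma> valuation_axiom by (auto split: if_splits)
next
  case (Mp_node \<chi> d e)
  then have "v (root_mark d) = one A" "imp A (v (root_mark d)) (v \<chi>) = one A"
    by (auto simp: valuation_simps)
  then show ?case
    by (simp add: imp_eq_one_iff[OF boolean_alg_s4c] leq_antisym[OF boolean_alg_s4c]
        leq_one[OF boolean_alg_s4c] valuation_simps carr_closed[OF boolean_alg_s4c])
next
  case (Nec_node \<chi> d)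
  then show ?case
    using interior_alg_s4c(2) by (auto simp: valuation_simps interior_alg_def)
next
  case (Omega_node \<chi> f)
  then obtain \<psi> \<phi> where root: "\<And>j. root_mark (f j) = (\<phi> j \<^bold>\<rightarrow> (Ev \<psi> \<^bold>\<and> Ev (\<phi> (Suc j))))"
    and \<chi>: "\<chi> = (\<phi> 0 \<^bold>\<rightarrow> Com \<psi>)"
    by auto
  have "v (root_mark (f j)) = one A" for j
    using Omega_node by (intro Omega_node.IH) auto
  then have "leq A (v (\<phi> j)) (meet A (ev A (v \<psi>)) (ev A (v (\<phi> (Suc j)))))" for j
    by (simp add: root valuation_simps valuation_Conj valuation_Ev imp_eq_one_iff[OF boolean_alg_s4c]
        ev_closed carr_closed[OF boolean_alg_s4c])
  then have "leq A (v (\<phi> 0)) (com A (v \<psi>))"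
    using standard valuation_simps(1)
    by (auto simp: standard_def dest!: bspec[of _ _ "v \<psi>"] spec[of _ "\<lambda>j. v (\<phi> j)"])
  then show ?case
    by (simp add: \<chi> valuation_simps imp_eq_one_iff[OF boolean_alg_s4c] box_com_closed)
qed

end

text \<open>A filter is the intersection of the ultrafilters extending it, and in an ultrafilter the finite
  conjunction of premises is evaluated like in a truth assignment.\<close>

theorem algebraic_soundness:
  fixes \<Sigma> :: "'i::finite fm set"
  assumes "derivable \<Sigma> \<Gamma> \<phi>"
  shows "alg_consequence TYPE('a) \<Sigma> \<Gamma> \<phi>"
  unfolding alg_consequence_def
proof (intro allI impI)
  fix A :: "('i, 'a) s4c_alg" and v
  assume "S4C_algebra A \<and> standard A \<and> alg_valuation A v \<and> (\<forall>\<xi>\<in>\<Sigma>. v \<xi> = one A)"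
  then have A: "S4C_algebra A" and v: "alg_valuation A v" and std: "standard A"
    and \<Sigma>: "\<forall>\<xi>\<in>\<Sigma>. v \<xi> = one A"
    by auto
  note B = boolean_alg_s4c[OF A v]
  obtain G where G: "finite G" "G \<subseteq> \<Gamma>" "\<Sigma> \<turnstile>\<^sub>g (Conj_set G \<^bold>\<rightarrow> \<phi>)"
    using assms unfolding derivable_def by blast
  obtain d where "omega_derivation d" "root_mark d = (Conj_set G \<^bold>\<rightarrow> \<phi>)" "assumptions d \<subseteq> \<Sigma>"
    using G(3) unfolding derivable_g_def by blast
  then have one: "v (Conj_set G \<^bold>\<rightarrow> \<phi>) = one A"
    using valuation_derivation[OF A v std \<Sigma>, of d] by simp
  have "v \<phi> \<in> F" if F: "alg_filter A F" "v ` \<Gamma> \<subseteq> F" for F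
  proof (rule ccontr)
    assume "v \<phi> \<notin> F"
    then obtain U where U: "ultrafilter A U" "F \<subseteq> U" "v \<phi> \<notin> U"
      using ultrafilter_avoiding[OF B F(1)] valuation_simps(1)[OF A v] by blast
    have "v (Conj_set G \<^bold>\<rightarrow> \<phi>) \<in> U"
      by (simp add: one ultrafilter_mem[OF B U(1)])
    moreover have "v (Conj_set G) \<in> U"
      using G(1,2) F(2) U(2)
      by (auto simp: truth_assignment_Conj_set[OF truth_assignment_ultrafilter[OF A v U(1)]])
    ultimately show False
      using U(3) by (simp add: truth_assignment_simps(2)[OF truth_assignment_ultrafilter[OF A v U(1)]])
  qed
  then show "v \<phi> \<in> filter_gen A (v ` \<Gamma>)"
    by (simp add: filter_gen_def)
qed

section \<open>Topological models as standard algebras\<close>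

definition powerset_algebra :: "'x set \<Rightarrow> ('i \<Rightarrow> 'x topology) \<Rightarrow> ('i, 'x set) s4c_alg" where
  "powerset_algebra X T =
    \<lparr>carr = Pow X, meet = (\<inter>), join = (\<union>), compl = (\<lambda>a. X - a), zero = {}, one = X,
     box = (\<lambda>i a. T i interior_of a), com = (\<lambda>a. inter_topology T interior_of a)\<rparr>"

lemma powerset_algebra_simps:
  "carr (powerset_algebra X T) = Pow X"
  "meet (powerset_algebra X T) = (\<inter>)"
  "join (powerset_algebra X T) = (\<union>)"
  "compl (powerset_algebra X T) a = X - a"
  "zero (powerset_algebra X T) = {}"
  "one (powerset_algebra X T) = X"
  "box (powerset_algebra X T) i = (\<lambda>a. T i interior_of a)"
  "com (powerset_algebra X T) = (\<lambda>a. inter_topology T interior_of a)"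
  "leq (powerset_algebra X T) a b \<longleftrightarrow> a \<subseteq> b"
  by (auto simp: powerset_algebra_def leq_def)

context
  fixes X :: "'x set" and T :: "'i::finite \<Rightarrow> 'x topology"
  assumes T: "\<And>i. topspace (T i) = X"
begin

lemma topspace_inter_topology: "topspace (inter_topology T) = X"
proof (rule subset_antisym)
  have "openin (T i) (topspace (inter_topology T))" for i
    using openin_topspace[of "inter_topology T"] unfolding openin_inter_topology by blast
  then show "topspace (inter_topology T) \<subseteq> X"
    using T openin_subset by blast
  have "openin (inter_topology T) X"
    using T openin_topspace by (metis openin_inter_topology)
  then show "X \<subseteq> topspace (inter_topology T)"
    by (rule openin_subset)
qed

lemma openin_all_interior_of:
  "(\<And>i. openin (T i) U) \<Longrightarrow> U \<subseteq> a \<Longrightarrow> U \<subseteq> inter_topology T interior_of a"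
  by (rule interior_of_maximal) (simp_all add: openin_inter_topology)

lemma openin_inter_interior_of: "openin (T i) (inter_topology T interior_of a)"
  using openin_interior_of[of "inter_topology T" a] unfolding openin_inter_topology by blast

lemma boolean_alg_powerset: "boolean_alg (powerset_algebra X T)"
  by (auto simp: boolean_alg_def powerset_algebra_simps)

lemma interior_alg_powerset:
  assumes "topspace \<tau> = X"
  shows "interior_alg (powerset_algebra X T) (\<lambda>a. \<tau> interior_of a)"
  using assms interior_of_subset_topspace[of \<tau>] interior_of_subset[of \<tau>]
  by (auto simp: interior_alg_def boolean_alg_powerset powerset_algebra_simps interior_of_Int)

lemma ev_powerset:
  assumes "a \<subseteq> X"
  shows "ev (powerset_algebra X T) a = (\<Inter>i. T i interior_of a)"
proof -
  have "foldr (meet (powerset_algebra X T))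
      (map (\<lambda>i. box (powerset_algebra X T) i a) is) (one (powerset_algebra X T)) =
      X \<inter> (\<Inter>i\<in>set is. T i interior_of a)" for "is"
    by (induction "is") (auto simp: powerset_algebra_simps)
  then show ?thesis
    using list_of[of "UNIV :: 'i set"] interior_of_subset_topspace[of "T undefined" a]
    by (auto simp: ev_def T)
qed

text \<open>For the induction inequality, let \<open>V\<close> be its left-hand side and \<open>U\<close> the interior, in the
  intersection topology, of the implication from \<open>a\<close> to \<open>ev a\<close>. Inside \<open>U\<close> all the interiors of \<open>a\<close>
  coincide, so \<open>V\<close> is, for every \<open>i\<close>, the intersection of \<open>U\<close> with the \<open>i\<close>-interior of \<open>a\<close>. Hence \<open>V\<close> is open in all topologies.\<close>

lemma S4C_algebra_powerset: "S4C_algebra (powerset_algebra X T)"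
proof -
  let ?A = "powerset_algebra X T" and ?C = "\<lambda>a. inter_topology T interior_of a"
  have mix: "?C a \<subseteq> ev ?A a \<inter> ev ?A (?C a)" if a: "a \<subseteq> X" for a
  proof -
    have "?C a \<subseteq> X"
      using interior_of_subset_topspace[of "inter_topology T" a] by (simp add: topspace_inter_topology)
    moreover have "?C a \<subseteq> T i interior_of a" "?C a \<subseteq> T i interior_of ?C a" for i
      by (rule interior_of_maximal; simp add: interior_of_subset openin_inter_interior_of)+
    ultimately show ?thesis
      unfolding ev_powerset[OF a] ev_powerset[OF \<open>?C a \<subseteq> X\<close>] by blast
  qed
  have ind: "ev ?A a \<inter> ?C (imp ?A a (ev ?A a)) \<subseteq> ?C a" if a: "a \<subseteq> X" for a
  proof -
    define V where "V = ev ?A a \<inter> ?C (imp ?A a (ev ?A a))"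
    have sub: "T i interior_of a \<subseteq> a" for i
      by (rule interior_of_subset)
    have "V = T i interior_of a \<inter> ?C (imp ?A a (ev ?A a))" for i
      using sub interior_of_subset[of "inter_topology T" "imp ?A a (ev ?A a)"] a
      unfolding V_def by (auto simp: ev_powerset imp_def powerset_algebra_simps)
    then have "openin (T i) V" for i
      by (metis openin_Int openin_interior_of openin_inter_interior_of)
    moreover have "V \<subseteq> a"
      using sub[of undefined] a unfolding V_def by (auto simp: ev_powerset)
    ultimately show ?thesis
      unfolding V_def by (rule openin_all_interior_of)
  qed
  show ?thesis
    using mix ind
    by (auto simp: S4C_algebra_def boolean_alg_powerset interior_alg_powerset T
        topspace_inter_topology powerset_algebra_simps)
qed

text \<open>The union of the sequence is a post-fixed point of every interior operator, hence open in all
  topologies, and it is contained in \<open>d\<close>.\<close>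

lemma standard_powerset: "standard (powerset_algebra X T)"
  unfolding standard_def
proof (intro ballI allI impI)
  let ?A = "powerset_algebra X T"
  fix d and a :: "nat \<Rightarrow> 'x set"
  assume d: "d \<in> carr ?A"
    and "(\<forall>j. a j \<in> carr ?A) \<and> (\<forall>j. leq ?A (a j) (meet ?A (ev ?A d) (ev ?A (a (Suc j)))))"
  then have carr: "d \<subseteq> X" "\<And>j. a j \<subseteq> X"
    and "\<And>j. a j \<subseteq> ev ?A d \<inter> ev ?A (a (Suc j))"
    by (auto simp: powerset_algebra_simps)
  then have step: "a j \<subseteq> T i interior_of d" "a j \<subseteq> T i interior_of a (Suc j)" for i j
    using ev_powerset[OF carr(1)] ev_powerset[OF carr(2)] by blast+
  have "openin (T i) (\<Union>j. a j)" for i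
  proof -
    have "T i interior_of a (Suc j) \<subseteq> T i interior_of (\<Union>j. a j)" for j
      by (rule interior_of_mono) blast
    then have "(\<Union>j. a j) \<subseteq> T i interior_of (\<Union>j. a j)"
      using step(2)[of _ i] by blast
    then show ?thesis
      using interior_of_subset[of "T i" "\<Union>j. a j"] by (simp flip: interior_of_eq add: subset_antisym)
  qed
  moreover have "(\<Union>j. a j) \<subseteq> d"
    using step(1)[of _ undefined] interior_of_subset[of "T undefined" d] by blast
  ultimately have "(\<Union>j. a j) \<subseteq> inter_topology T interior_of d"
    by (rule openin_all_interior_of)
  then show "leq ?A (a 0) (com ?A d)"
    by (auto simp: powerset_algebra_simps)
qed

end

text \<open>Local consequence at \<open>x\<close> is membership in the principal ultrafilter of the sets containing \<open>x\<close>.\<close>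

theorem topological_soundness:
  fixes \<Sigma> :: "'i::finite fm set"
  assumes "derivable \<Sigma> \<Gamma> \<phi>"
  shows "top_consequence TYPE('x) \<Sigma> \<Gamma> \<phi>"
  unfolding top_consequence_def
proof (intro allI impI)
  fix X :: "'x set" and T :: "'i \<Rightarrow> 'x topology" and v x
  assume "top_model X T v \<and> x \<in> X \<and> (\<forall>\<xi>\<in>\<Sigma>. v \<xi> = X) \<and> (\<forall>\<psi>\<in>\<Gamma>. x \<in> v \<psi>)"
  then have M: "top_model X T v" and x: "x \<in> X" and \<Sigma>: "\<forall>\<xi>\<in>\<Sigma>. v \<xi> = X"
    and \<Gamma>: "\<forall>\<psi>\<in>\<Gamma>. x \<in> v \<psi>"
    by auto
  let ?A = "powerset_algebra X T"
  have T: "topspace (T i) = X" for i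
    using M by (simp add: top_model_def)
  have "alg_valuation ?A v"
    using M by (auto simp: top_model_def alg_valuation_def powerset_algebra_simps imp_def)
  then have "v \<phi> \<in> filter_gen ?A (v ` \<Gamma>)"
    using algebraic_soundness[OF assms, where 'a = "'x set"] S4C_algebra_powerset[of T X, OF T]
      standard_powerset[of T X, OF T] \<Sigma>
    unfolding alg_consequence_def by (simp add: powerset_algebra_simps)
  moreover have "alg_filter ?A {a. a \<subseteq> X \<and> x \<in> a}"
    using x by (auto simp: alg_filter_def powerset_algebra_simps)
  moreover have "v ` \<Gamma> \<subseteq> {a. a \<subseteq> X \<and> x \<in> a}"
    using M \<Gamma> by (auto simp: top_model_def)
  ultimately show "x \<in> v \<phi>"
    by (auto simp: filter_gen_def)
qed

section \<open>Soundness and completeness\<close>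

theorem theorem3:
  fixes \<Sigma> \<Gamma> :: "'i::finite fm set" and \<phi> :: "'i fm"
  shows "(derivable \<Sigma> \<Gamma> \<phi> \<longleftrightarrow> alg_consequence TYPE('i fm set) \<Sigma> \<Gamma> \<phi>) \<and>
         (alg_consequence TYPE('i fm set) \<Sigma> \<Gamma> \<phi> \<longleftrightarrow> top_consequence TYPE('i fm set) \<Sigma> \<Gamma> \<phi>) \<and>
         (derivable \<Sigma> \<Gamma> \<phi> \<longrightarrow> alg_consequence TYPE('a) \<Sigma> \<Gamma> \<phi>) \<and>
         (derivable \<Sigma> \<Gamma> \<phi> \<longrightarrow> top_consequence TYPE('x) \<Sigma> \<Gamma> \<phi>)"
  using algebraic_soundness[of \<Sigma> \<Gamma> \<phi>] topological_soundness[of \<Sigma> \<Gamma> \<phi>]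
    algebraic_completeness[of \<Sigma> \<Gamma> \<phi>] topological_completeness[of \<Sigma> \<Gamma> \<phi>]
  by metis

end
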